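(* Let $\lambda,\mu\in\mathbb{R}$ and $\delta=\mu-\lambda$. If $\delta\notin\{0,1,2,\dots\}$, or if $\delta\in\{1,2,3,\dots\}$ and $\lambda\neq\frac{1-\delta}{2}$, then $H(s\ell_2,\mathcal{D}_{\lambda\mu}(\mathbb{R}))=0$.
   Context: $s\ell_2$ denotes the Lie subalgebra of the Lie algebra of smooth vector fields on $\mathbb{R}$ spanned by $\frac{d}{dt}$, $t\frac{d}{dt}$, $t^2\frac{d}{dt}$. The space of $\lambda$-densities $g|dt|^\lambda$ on $\mathbb{R}$ is identified with $C_\infty(\mathbb{R})$, with Lie derivative $L^\lambda_{f\frac{d}{dt}}g=f\frac{dg}{dt}+\lambda\frac{df}{dt}g$. $\mathcal{D}_{\lambda\mu}(\mathbb{R})$ is the space of linear differential operators (finite order, smooth coefficients) from $\lambda$-densities to $\mu$-densities, with $X$ acting by $A\mapsto L^\mu_X\circ A-A\circ L^\lambda_X$. $H(s\ell_2,W)=\bigoplus_uH^u(s\ell_2,W)$ is Chevalley–Eilenberg cohomology with coefficients in the module $W$. *)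

theory Defs
  imports "HOL-Analysis.Analysis"
begin

section \<open>The algebra of smooth functions on the real line\<close>

definition smooth :: "(real \<Rightarrow> real) \<Rightarrow> bool" where
  "smooth f \<longleftrightarrow> (\<forall>n t. (deriv ^^ n) f differentiable at t)"

lemma smooth_differentiable: "smooth f \<Longrightarrow> f field_differentiable at t"
  unfolding smooth_def
  by (metis funpow_0 field_differentiable_def real_differentiable_def)

lemma smooth_coinduct:
  assumes "S f"
    and "\<And>g t. S g \<Longrightarrow> g field_differentiable at t"
    and "\<And>g. S g \<Longrightarrow> S (deriv g)"
  shows "smooth f"
proof -
  have "S ((deriv ^^ n) f)" for n
    by (induction n) (auto intro: assms)
  then show ?thesis
    using assms(2) by (auto simp: smooth_def field_differentiable_def real_differentiable_def)
qed

lemma smooth_deriv: "smooth f \<Longrightarrow> smooth (deriv f)"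
  unfolding smooth_def by (metis funpow_swap1 funpow.simps(2) comp_apply)

lemma smooth_const: "smooth (\<lambda>t. c)"
  by (rule smooth_coinduct[where S = "\<lambda>f. \<exists>c. f = (\<lambda>t. c)"]) auto

lemma smooth_id: "smooth (\<lambda>t. t)"
  by (rule smooth_coinduct[where S = "\<lambda>f. f = (\<lambda>t. t) \<or> (\<exists>c. f = (\<lambda>t. c))"]) auto

lemma smooth_add:
  assumes "smooth f" "smooth g"
  shows "smooth (\<lambda>t. f t + g t)"
proof (rule smooth_coinduct[where S = "\<lambda>h. \<exists>f g. h = (\<lambda>t. f t + g t) \<and> smooth f \<and> smooth g"])
  show "\<exists>f' g'. (\<lambda>t. f t + g t) = (\<lambda>t. f' t + g' t) \<and> smooth f' \<and> smooth g'"
    using assms by blast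
next
  fix h t assume "\<exists>f g. h = (\<lambda>t. f t + g t) \<and> smooth f \<and> smooth g"
  then show "h field_differentiable at t"
    using field_differentiable_add smooth_differentiable by blast
next
  fix h assume "\<exists>f g. h = (\<lambda>t. f t + g t) \<and> smooth f \<and> smooth g"
  then obtain f g where h: "h = (\<lambda>t. f t + g t)" "smooth f" "smooth g"
    by blast
  then have "deriv h = (\<lambda>t. deriv f t + deriv g t)"
    by (auto simp: smooth_differentiable)
  with h show "\<exists>f g. deriv h = (\<lambda>t. f t + g t) \<and> smooth f \<and> smooth g"
    using smooth_deriv by blast
qed

lemma smooth_mult:
  assumes "smooth f" "smooth g"
  shows "smooth (\<lambda>t. f t * g t)"
proof -
  define S :: "nat \<Rightarrow> (real \<Rightarrow> real) set" where "S = rec_nat {h. \<forall>t. h field_differentiable at t}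
    (\<lambda>_ A. {h. (\<forall>t. h field_differentiable at t) \<and> deriv h \<in> A})"
  have S0: "S 0 = {h. \<forall>t. h field_differentiable at t}"
    and SSuc: "S (Suc n) = {h. (\<forall>t. h field_differentiable at t) \<and> deriv h \<in> S n}" for n
    by (simp_all add: S_def)
  have diff: "h field_differentiable at t" if "h \<in> S n" for h n t
    using that by (cases n) (auto simp: S0 SSuc)
  have add: "(\<lambda>t. p t + q t) \<in> S n" if "p \<in> S n" "q \<in> S n" for p q n
    using that
  proof (induction n arbitrary: p q)
    case 0
    then show ?case by (auto simp: S0 intro: field_differentiable_add)
  next
    case (Suc n)
    then have "deriv (\<lambda>t. p t + q t) = (\<lambda>t. deriv p t + deriv q t)"
      by (auto simp: SSuc)
    with Suc show ?case by (auto simp: SSuc intro: field_differentiable_add)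
  qed
  have mult: "(\<lambda>t. p t * q t) \<in> S n" if "smooth p" "smooth q" for p q n
    using that
  proof (induction n arbitrary: p q)
    case 0
    then show ?case
      by (auto simp: S0 intro: field_differentiable_mult smooth_differentiable)
  next
    case (Suc n)
    then have "deriv (\<lambda>t. p t * q t) = (\<lambda>t. p t * deriv q t + deriv p t * q t)"
      by (auto simp: smooth_differentiable)
    moreover have "(\<lambda>t. p t * deriv q t + deriv p t * q t) \<in> S n"
      by (intro add Suc.IH smooth_deriv Suc.prems)
    ultimately show ?case
      using Suc.prems by (auto simp: SSuc intro: field_differentiable_mult smooth_differentiable)
  qed
  have "\<forall>n. (\<lambda>t. f t * g t) \<in> S n"
    using mult assms by blast
  then show ?thesis
  proof (rule smooth_coinduct[where S = "\<lambda>h. \<forall>n. h \<in> S n"])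
    fix h assume "\<forall>n. h \<in> S n"
    then show "\<forall>n. deriv h \<in> S n" using SSuc by blast
  qed (use diff in blast)
qed

typedef smooth_fun = "{f :: real \<Rightarrow> real. smooth f}"
  morphisms app Smooth
  using smooth_const by blast

setup_lifting type_definition_smooth_fun

instantiation smooth_fun :: comm_ring_1
begin

lift_definition zero_smooth_fun :: smooth_fun is "\<lambda>t. 0" by (rule smooth_const)

lift_definition one_smooth_fun :: smooth_fun is "\<lambda>t. 1" by (rule smooth_const)

lift_definition plus_smooth_fun :: "smooth_fun \<Rightarrow> smooth_fun \<Rightarrow> smooth_fun"
  is "\<lambda>f g t. f t + g t" by (rule smooth_add)

lift_definition times_smooth_fun :: "smooth_fun \<Rightarrow> smooth_fun \<Rightarrow> smooth_fun"
  is "\<lambda>f g t. f t * g t" by (rule smooth_mult)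

lift_definition uminus_smooth_fun :: "smooth_fun \<Rightarrow> smooth_fun"
  is "\<lambda>f t. - f t"
  using smooth_mult[OF smooth_const[of "-1"]] by simp

lift_definition minus_smooth_fun :: "smooth_fun \<Rightarrow> smooth_fun \<Rightarrow> smooth_fun"
  is "\<lambda>f g t. f t - g t"
  using smooth_add[OF _ smooth_mult[OF smooth_const[of "-1"]]] by simp

instance
  by standard (transfer; auto simp: algebra_simps fun_eq_iff)+

end

instantiation smooth_fun :: real_algebra_1
begin

lift_definition scaleR_smooth_fun :: "real \<Rightarrow> smooth_fun \<Rightarrow> smooth_fun"
  is "\<lambda>r f t. r * f t" by (intro smooth_mult smooth_const)

instance
  by standard (transfer; auto simp: algebra_simps fun_eq_iff)+

end

lift_definition ident :: smooth_fun is "\<lambda>t. t" by (rule smooth_id)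

lift_definition D :: "smooth_fun \<Rightarrow> smooth_fun" is deriv by (rule smooth_deriv)

lemma D_add: "D (f + g) = D f + D g"
  by transfer (auto simp: smooth_differentiable)

lemma D_mult: "D (f * g) = D f * g + f * D g"
  by transfer (auto simp: smooth_differentiable)

lemma D_scaleR: "D (r *\<^sub>R f) = r *\<^sub>R D f"
  by transfer (auto simp: smooth_differentiable)

lemma D_zero: "D 0 = 0"
  by transfer auto

lemma D_one: "D 1 = 0"
  by transfer auto

lemma D_ident: "D ident = 1"
  by transfer auto

lemma D_minus: "D (f - g) = D f - D g"
  using D_add[of "f - g" g] by simp

lemma D_sum: "D (sum f A) = (\<Sum>i\<in>A. D (f i))"
  by (induction A rule: infinite_finite_induct) (auto simp: D_add D_zero)


section \<open>Vector fields and densities\<close>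

text \<open>The vector field \<open>f d/dt\<close> and the density \<open>g |dt|\<^sup>\<lambda>\<close> are represented by their
  coefficients \<open>f\<close> and \<open>g\<close>. The commutator of \<open>f d/dt\<close> and \<open>g d/dt\<close> is
  \<open>(f g' - g f') d/dt\<close>.\<close>

definition vf_bracket :: "smooth_fun \<Rightarrow> smooth_fun \<Rightarrow> smooth_fun" where
  "vf_bracket f g = f * D g - g * D f"

definition sl2 :: "smooth_fun set" where
  "sl2 = span {1, ident, ident ^ 2}"

definition lie_density :: "real \<Rightarrow> smooth_fun \<Rightarrow> smooth_fun \<Rightarrow> smooth_fun" where
  "lie_density lam f g = f * D g + lam *\<^sub>R (D f * g)"


section \<open>Differential operators\<close>

definition is_diff_op :: "(smooth_fun \<Rightarrow> smooth_fun) \<Rightarrow> bool" where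
  "is_diff_op A \<longleftrightarrow> (\<exists>k a. \<forall>g. A g = (\<Sum>i\<le>k. a i * (D ^^ i) g))"

lemma is_diff_op_zero: "is_diff_op (\<lambda>g. 0)"
  unfolding is_diff_op_def by (rule exI[of _ 0], rule exI[of _ "\<lambda>_. 0"]) simp

lemma is_diff_op_id: "is_diff_op (\<lambda>g. g)"
  unfolding is_diff_op_def by (rule exI[of _ 0], rule exI[of _ "\<lambda>_. 1"]) simp

lemma is_diff_op_add:
  assumes "is_diff_op A" "is_diff_op B"
  shows "is_diff_op (\<lambda>g. A g + B g)"
proof -
  obtain k a where A: "\<And>g. A g = (\<Sum>i\<le>k. a i * (D ^^ i) g)"
    using assms(1) unfolding is_diff_op_def by blast
  obtain l b where B: "\<And>g. B g = (\<Sum>i\<le>l. b i * (D ^^ i) g)"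
    using assms(2) unfolding is_diff_op_def by blast
  have A': "A g = (\<Sum>i\<le>max k l. (if i \<le> k then a i else 0) * (D ^^ i) g)" for g
    unfolding A by (rule sum.mono_neutral_cong_left) auto
  have B': "B g = (\<Sum>i\<le>max k l. (if i \<le> l then b i else 0) * (D ^^ i) g)" for g
    unfolding B by (rule sum.mono_neutral_cong_left) auto
  show ?thesis
    unfolding is_diff_op_def
    by (rule exI[of _ "max k l"],
        rule exI[of _ "\<lambda>i. (if i \<le> k then a i else 0) + (if i \<le> l then b i else 0)"])
       (simp add: A' B' distrib_right sum.distrib)
qed

lemma is_diff_op_sum:
  assumes "\<And>i. i \<in> I \<Longrightarrow> is_diff_op (A i)"
  shows "is_diff_op (\<lambda>g. \<Sum>i\<in>I. A i g)"
  using assms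
  by (induction I rule: infinite_finite_induct) (auto intro: is_diff_op_zero is_diff_op_add)

lemma is_diff_op_mult:
  assumes "is_diff_op A"
  shows "is_diff_op (\<lambda>g. f * A g)"
proof -
  obtain k a where A: "\<And>g. A g = (\<Sum>i\<le>k. a i * (D ^^ i) g)"
    using assms unfolding is_diff_op_def by blast
  show ?thesis
    unfolding is_diff_op_def
    by (rule exI[of _ k], rule exI[of _ "\<lambda>i. f * a i"])
       (simp add: A sum_distrib_left mult.assoc)
qed

lemma is_diff_op_scaleR: "is_diff_op A \<Longrightarrow> is_diff_op (\<lambda>g. r *\<^sub>R A g)"
  using is_diff_op_mult[of A "r *\<^sub>R 1"] by simp

lemma is_diff_op_D:
  assumes "is_diff_op A"
  shows "is_diff_op (\<lambda>g. D (A g))"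
proof -
  obtain k a where A: "\<And>g. A g = (\<Sum>i\<le>k. a i * (D ^^ i) g)"
    using assms unfolding is_diff_op_def by blast
  have pow: "is_diff_op (\<lambda>g. (D ^^ i) g)" for i
    unfolding is_diff_op_def
    by (rule exI[of _ i], rule exI[of _ "\<lambda>j. if j = i then 1 else 0"])
       (simp add: if_distrib[of "\<lambda>x. x * _"] cong: if_cong)
  have "(\<lambda>g. D (A g)) = (\<lambda>g. \<Sum>i\<le>k. D (a i) * (D ^^ i) g + a i * (D ^^ Suc i) g)"
    by (simp add: A D_sum D_mult)
  moreover have "is_diff_op (\<lambda>g. \<Sum>i\<le>k. D (a i) * (D ^^ i) g + a i * (D ^^ Suc i) g)"
    by (intro is_diff_op_sum is_diff_op_add is_diff_op_mult pow)
  ultimately show ?thesis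
    by (simp only:)
qed

lemma is_diff_op_comp:
  assumes "is_diff_op A" "is_diff_op B"
  shows "is_diff_op (\<lambda>g. A (B g))"
proof -
  obtain k a where A: "\<And>g. A g = (\<Sum>i\<le>k. a i * (D ^^ i) g)"
    using assms(1) unfolding is_diff_op_def by blast
  have "is_diff_op (\<lambda>g. (D ^^ i) (B g))" for i
    by (induction i) (use assms(2) in \<open>auto intro: is_diff_op_D\<close>)
  then show ?thesis
    unfolding A by (intro is_diff_op_sum is_diff_op_mult)
qed

lemma is_diff_op_lie_density: "is_diff_op (lie_density lam X)"
proof -
  have "is_diff_op (\<lambda>g. X * D g + lam *\<^sub>R (D X * g))"
    by (intro is_diff_op_add is_diff_op_scaleR is_diff_op_mult is_diff_op_D is_diff_op_id)
  then show ?thesis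
    unfolding lie_density_def .
qed

text \<open>The underlying vector space of \<open>\<D>\<^sub>\<lambda>\<^sub>\<mu>(\<real>)\<close> does not depend on \<open>\<lambda>\<close> and \<open>\<mu>\<close>; only the
  action \<open>lie_diff_op\<close> does.\<close>

typedef diff_op = "{A :: smooth_fun \<Rightarrow> smooth_fun. is_diff_op A}"
  morphisms op_app Diff_Op
  using is_diff_op_zero by blast

setup_lifting type_definition_diff_op

instantiation diff_op :: real_vector
begin

lift_definition zero_diff_op :: diff_op is "\<lambda>g. 0" by (rule is_diff_op_zero)

lift_definition plus_diff_op :: "diff_op \<Rightarrow> diff_op \<Rightarrow> diff_op"
  is "\<lambda>A B g. A g + B g" by (rule is_diff_op_add)

lift_definition uminus_diff_op :: "diff_op \<Rightarrow> diff_op"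
  is "\<lambda>A g. - A g"
  using is_diff_op_scaleR[of _ "-1"] by simp

lift_definition minus_diff_op :: "diff_op \<Rightarrow> diff_op \<Rightarrow> diff_op"
  is "\<lambda>A B g. A g - B g"
  using is_diff_op_add[OF _ is_diff_op_scaleR[of _ "-1"]] by simp

lift_definition scaleR_diff_op :: "real \<Rightarrow> diff_op \<Rightarrow> diff_op"
  is "\<lambda>r A g. r *\<^sub>R A g" by (rule is_diff_op_scaleR)

instance
  by standard (transfer; auto simp: algebra_simps fun_eq_iff)+

end

lift_definition lie_diff_op :: "real \<Rightarrow> real \<Rightarrow> smooth_fun \<Rightarrow> diff_op \<Rightarrow> diff_op"
  is "\<lambda>lam mu X A g. lie_density mu X (A g) - A (lie_density lam X g)"
proof -
  fix lam mu X and A :: "smooth_fun \<Rightarrow> smooth_fun"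
  assume A: "is_diff_op A"
  have "is_diff_op (\<lambda>g. lie_density mu X (A g) + (- 1) *\<^sub>R A (lie_density lam X g))"
    using is_diff_op_add[OF is_diff_op_comp[OF is_diff_op_lie_density A]
        is_diff_op_scaleR[OF is_diff_op_comp[OF A is_diff_op_lie_density]]] .
  then show "is_diff_op (\<lambda>g. lie_density mu X (A g) - A (lie_density lam X g))"
    by simp
qed

lemma sl2_iff: "X \<in> sl2 \<longleftrightarrow> (\<exists>a b c. X = a *\<^sub>R 1 + b *\<^sub>R ident + c *\<^sub>R ident ^ 2)"
proof -
  have "X - a *\<^sub>R 1 - b *\<^sub>R ident - c *\<^sub>R ident ^ 2 = 0 \<longleftrightarrow>
      X = a *\<^sub>R 1 + b *\<^sub>R ident + c *\<^sub>R ident ^ 2" for a b c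
    by (simp only: diff_diff_eq right_minus_eq)
  then show ?thesis
    by (simp only: sl2_def span_insert span_empty mem_Collect_eq singleton_iff)
qed

lemma sl2_bracket:
  assumes "X \<in> sl2" "Y \<in> sl2"
  shows "vf_bracket X Y \<in> sl2"
proof -
  obtain a b c a' b' c' where
    X: "X = a *\<^sub>R 1 + b *\<^sub>R ident + c *\<^sub>R ident ^ 2" and
    Y: "Y = a' *\<^sub>R 1 + b' *\<^sub>R ident + c' *\<^sub>R ident ^ 2"
    using assms unfolding sl2_iff by blast
  have DX: "D X = b *\<^sub>R 1 + (2 * c) *\<^sub>R ident" and DY: "D Y = b' *\<^sub>R 1 + (2 * c') *\<^sub>R ident"
    unfolding X Y power2_eq_square D_add D_scaleR D_mult D_one D_ident
    by (transfer, simp add: fun_eq_iff)+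
  have "vf_bracket X Y =
      (a * b' - a' * b) *\<^sub>R 1 + (2 * (a * c' - a' * c)) *\<^sub>R ident + (b * c' - b' * c) *\<^sub>R ident ^ 2"
    unfolding vf_bracket_def DX DY unfolding X Y power2_eq_square
    by (transfer, simp add: fun_eq_iff algebra_simps)
  then show ?thesis
    unfolding sl2_iff by blast
qed

lemma lie_density_bracket:
  "lie_density lam (vf_bracket X Y) g =
     lie_density lam X (lie_density lam Y g) - lie_density lam Y (lie_density lam X g)"
  by (simp add: lie_density_def vf_bracket_def D_add D_minus D_scaleR D_mult algebra_simps)

lemma lie_diff_op_bracket:
  "lie_diff_op lam mu (vf_bracket X Y) A =
     lie_diff_op lam mu X (lie_diff_op lam mu Y A) - lie_diff_op lam mu Y (lie_diff_op lam mu X A)"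
proof (transfer, rule ext)
  fix lam mu X Y g and A :: "smooth_fun \<Rightarrow> smooth_fun"
  assume "is_diff_op A"
  then obtain k a where A: "A = (\<lambda>g. \<Sum>i\<le>k. a i * (D ^^ i) g)"
    unfolding is_diff_op_def by blast
  have pow: "(D ^^ i) (x - y) = (D ^^ i) x - (D ^^ i) y" for i x y
    by (induction i) (auto simp: D_minus)
  have A_minus: "A (x - y) = A x - A y" for x y
    by (simp add: A pow algebra_simps sum_subtractf)
  have dens: "lie_density mu Z (x - y) = lie_density mu Z x - lie_density mu Z y" for Z x y
    by (simp add: lie_density_def D_minus algebra_simps)
  show "lie_density mu (vf_bracket X Y) (A g) - A (lie_density lam (vf_bracket X Y) g) =
      lie_density mu X (lie_density mu Y (A g) - A (lie_density lam Y g)) -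
      (lie_density mu Y (A (lie_density lam X g)) -
       A (lie_density lam Y (lie_density lam X g))) -
      (lie_density mu Y (lie_density mu X (A g) - A (lie_density lam X g)) -
      (lie_density mu X (A (lie_density lam Y g)) -
       A (lie_density lam X (lie_density lam Y g))))"
    by (simp add: lie_density_bracket A_minus dens)
qed


section \<open>Chevalley--Eilenberg cohomology\<close>

text \<open>In this section \<open>L\<close> is a subspace of a real vector space that is a Lie algebra under
  \<open>br\<close>, and \<open>act\<close> makes the type \<open>'w\<close> an \<open>L\<close>-module. A \<open>u\<close>-cochain is an alternating
  \<open>u\<close>-linear map \<open>L\<^sup>u \<Rightarrow> 'w\<close>, taken as a function on lists that is \<open>0\<close> off the lists of
  length \<open>u\<close> over \<open>L\<close>, so that equality of cochains is equality of functions.\<close>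

definition CE_cochains ::
  "'g::real_vector set \<Rightarrow> nat \<Rightarrow> ('g list \<Rightarrow> 'w::real_vector) set" where
  "CE_cochains L u = {c.
     (\<forall>xs. \<not> (length xs = u \<and> set xs \<subseteq> L) \<longrightarrow> c xs = 0) \<and>
     (\<forall>xs i a b. \<forall>x\<in>L. \<forall>y\<in>L. length xs = u \<longrightarrow> set xs \<subseteq> L \<longrightarrow> i < u \<longrightarrow>
        c (xs[i := a *\<^sub>R x + b *\<^sub>R y]) = a *\<^sub>R c (xs[i := x]) + b *\<^sub>R c (xs[i := y])) \<and>
     (\<forall>xs i j. length xs = u \<longrightarrow> set xs \<subseteq> L \<longrightarrow> i < j \<longrightarrow> j < u \<longrightarrow> xs ! i = xs ! j \<longrightarrow>
        c xs = 0)}"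

text \<open>The list \<open>nths xs (- I)\<close> is \<open>xs\<close> with the entries at the positions in \<open>I\<close> omitted.\<close>

definition CE_diff ::
  "'g::real_vector set \<Rightarrow> ('g \<Rightarrow> 'g \<Rightarrow> 'g) \<Rightarrow> ('g \<Rightarrow> 'w \<Rightarrow> 'w) \<Rightarrow> nat \<Rightarrow>
   ('g list \<Rightarrow> 'w::real_vector) \<Rightarrow> 'g list \<Rightarrow> 'w" where
  "CE_diff L br act u c xs =
     (if length xs = Suc u \<and> set xs \<subseteq> L then
        (\<Sum>i\<le>u. (-1) ^ i *\<^sub>R act (xs ! i) (c (nths xs (- {i})))) +
        (\<Sum>j\<le>u. \<Sum>i<j. (-1) ^ (i + j) *\<^sub>R
           c (br (xs ! i) (xs ! j) # nths xs (- {i, j})))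
      else 0)"

definition CE_cocycles ::
  "'g::real_vector set \<Rightarrow> ('g \<Rightarrow> 'g \<Rightarrow> 'g) \<Rightarrow> ('g \<Rightarrow> 'w \<Rightarrow> 'w) \<Rightarrow> nat \<Rightarrow>
   ('g list \<Rightarrow> 'w::real_vector) set" where
  "CE_cocycles L br act u = {c \<in> CE_cochains L u. CE_diff L br act u c = (\<lambda>xs. 0)}"

fun CE_coboundaries ::
  "'g::real_vector set \<Rightarrow> ('g \<Rightarrow> 'g \<Rightarrow> 'g) \<Rightarrow> ('g \<Rightarrow> 'w \<Rightarrow> 'w) \<Rightarrow> nat \<Rightarrow>
   ('g list \<Rightarrow> 'w::real_vector) set" where
  "CE_coboundaries L br act 0 = {\<lambda>xs. 0}"
| "CE_coboundaries L br act (Suc u) = CE_diff L br act u ` CE_cochains L u"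

definition CE_cohomologous ::
  "'g::real_vector set \<Rightarrow> ('g \<Rightarrow> 'g \<Rightarrow> 'g) \<Rightarrow> ('g \<Rightarrow> 'w \<Rightarrow> 'w) \<Rightarrow> nat \<Rightarrow>
   (('g list \<Rightarrow> 'w::real_vector) \<times> ('g list \<Rightarrow> 'w)) set" where
  "CE_cohomologous L br act u =
     {(c, c'). c \<in> CE_cocycles L br act u \<and> c' \<in> CE_cocycles L br act u \<and>
        (\<lambda>xs. c xs - c' xs) \<in> CE_coboundaries L br act u}"

definition CE_cohomology ::
  "'g::real_vector set \<Rightarrow> ('g \<Rightarrow> 'g \<Rightarrow> 'g) \<Rightarrow> ('g \<Rightarrow> 'w \<Rightarrow> 'w) \<Rightarrow> nat \<Rightarrow>
   ('g list \<Rightarrow> 'w::real_vector) set set" where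
  "CE_cohomology L br act u = CE_cocycles L br act u // CE_cohomologous L br act u"

definition CE_zero_class ::
  "'g::real_vector set \<Rightarrow> ('g \<Rightarrow> 'g \<Rightarrow> 'g) \<Rightarrow> ('g \<Rightarrow> 'w \<Rightarrow> 'w) \<Rightarrow> nat \<Rightarrow>
   ('g list \<Rightarrow> 'w::real_vector) set" where
  "CE_zero_class L br act u = CE_cohomologous L br act u `` {\<lambda>xs. 0}"

text \<open>The direct sum over all degrees, as families of classes with finite support.\<close>

definition CE_total_cohomology ::
  "'g::real_vector set \<Rightarrow> ('g \<Rightarrow> 'g \<Rightarrow> 'g) \<Rightarrow> ('g \<Rightarrow> 'w \<Rightarrow> 'w) \<Rightarrow>
   (nat \<Rightarrow> ('g list \<Rightarrow> 'w::real_vector) set) set" where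
  "CE_total_cohomology L br act =
     {h. (\<forall>u. h u \<in> CE_cohomology L br act u) \<and> finite {u. h u \<noteq> CE_zero_class L br act u}}"

end

theory Submission
  imports Defs
begin

text \<open>
  The vector field \<open>d/dt\<close> acts on differential operators by differentiating the coefficients.
  This is surjective, and its kernel consists of the operators with constant coefficients. Hence
  every cocycle of \<open>sl\<^sub>2\<close> can be changed by a coboundary so that it vanishes as soon as one
  argument is \<open>d/dt\<close>; in degree 3 nothing is left. The remaining data in degrees 0, 1 and 2 are
  constant coefficient operators, up to a term linear in \<open>t\<close> that they determine. There
  \<open>t d/dt\<close> acts on \<open>D\<^sup>k\<close> with weight \<open>\<delta> - k\<close>, so only \<open>D\<^sup>\<delta>\<close> and \<open>D\<^sup>\<delta>\<^sup>-\<^sup>1\<close> can obstruct. These two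
  cancel each other, because \<open>t\<^sup>2 d/dt\<close> maps \<open>D\<^sup>\<delta>\<close> to \<open>- \<delta> (\<delta> - 1 + 2 \<lambda>) D\<^sup>\<delta>\<^sup>-\<^sup>1\<close>, and the hypotheses say
  that this factor does not vanish.
\<close>

lemma smooth_fun_eq_iff: "f = g \<longleftrightarrow> (\<forall>t. app f t = app g t)"
  by (simp add: app_inject[symmetric] fun_eq_iff)

lemma app_numeral: "app (numeral k) t = numeral k"
proof -
  have "app (of_real (numeral k)) t = numeral k"
    unfolding of_real_def by (simp add: scaleR_smooth_fun.rep_eq one_smooth_fun.rep_eq)
  then show ?thesis by simp
qed

lemmas app_simps = app_numeral plus_smooth_fun.rep_eq minus_smooth_fun.rep_eq times_smooth_fun.rep_eq
  scaleR_smooth_fun.rep_eq zero_smooth_fun.rep_eq one_smooth_fun.rep_eq ident.rep_eq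

section \<open>Derivatives and primitives\<close>

lemma D_eq_0_imp_const:
  assumes "D f = 0"
  obtains c where "f = c *\<^sub>R 1"
proof -
  have "\<exists>c. f = c *\<^sub>R 1"
    using assms
  proof (transfer)
    fix f :: "real \<Rightarrow> real" assume f: "smooth f" "deriv f = (\<lambda>t. 0)"
    have "(f has_real_derivative 0) (at x)" for x
      using smooth_differentiable[OF f(1), of x] f(2)
      by (metis field_differentiable_derivI)
    then have "f x = f 0" for x
      using DERIV_isconst_all by blast
    then show "\<exists>c. f = (\<lambda>t. c * 1)" by auto
  qed
  then show ?thesis using that by blast
qed

lemma D_surj: "\<exists>g. D g = f"
proof transfer
  fix f :: "real \<Rightarrow> real" assume f: "smooth f"
  have "\<exists>F. \<forall>x::real. (-\<infinity>::ereal) < x \<longrightarrow> x < (\<infinity>::ereal) \<longrightarrow> (F has_vector_derivative f x) (at x)"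
    by (rule einterval_antiderivative)
       (auto intro!: field_differentiable_imp_continuous_at smooth_differentiable f)
  then obtain F where "\<And>x. (F has_vector_derivative f x) (at x)"
    by auto
  then have F: "(F has_real_derivative f x) (at x)" for x
    by (simp add: has_real_derivative_iff_has_vector_derivative)
  then have d: "deriv F = f"
    by (intro ext DERIV_imp_deriv)
  have "smooth F"
  proof (rule smooth_coinduct[where S = "\<lambda>h. smooth h \<or> h = F"])
    show "g field_differentiable at t" if "smooth g \<or> g = F" for g t
      using that F smooth_differentiable unfolding field_differentiable_def by blast
  qed (use f d in \<open>auto intro: smooth_deriv\<close>)
  with d show "\<exists>g\<in>Collect smooth. deriv g = f" by auto
qed

lemma D_pow_add: "(D ^^ i) (f + g) = (D ^^ i) f + (D ^^ i) g"
  by (induction i) (auto simp: D_add)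

lemma D_pow_scaleR: "(D ^^ i) (r *\<^sub>R f) = r *\<^sub>R (D ^^ i) f"
  by (induction i) (auto simp: D_scaleR)

lemma D_ident_sq: "D (ident ^ 2) = 2 *\<^sub>R ident"
  by (simp add: power2_eq_square D_mult D_ident scaleR_2)

section \<open>The action of \<open>sl\<^sub>2\<close> on coefficients\<close>

lemma lie_density_1 [simp]: "lie_density l 1 g = D g"
  by (simp add: lie_density_def D_one)

lemma lie_density_ident [simp]: "lie_density l ident g = ident * D g + l *\<^sub>R g"
  by (simp add: lie_density_def D_ident)

lemma lie_density_ident_sq [simp]:
  "lie_density l (ident\<^sup>2) g = ident\<^sup>2 * D g + (2 * l) *\<^sub>R (ident * g)"
  by (simp add: lie_density_def D_ident_sq)

lemma D_pow_lie_density_ident: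
  "(D ^^ i) (lie_density l ident g) = ident * (D ^^ Suc i) g + (real i + l) *\<^sub>R (D ^^ i) g"
proof (induction i)
  case (Suc i)
  show ?case
    by (simp only: funpow.simps comp_apply Suc D_add D_mult D_scaleR D_ident)
       (simp add: smooth_fun_eq_iff app_simps algebra_simps)
qed simp

lemma D_pow_lie_density_ident_sq:
  "(D ^^ i) (lie_density l (ident\<^sup>2) g) =
     ident\<^sup>2 * (D ^^ Suc i) g + (2 * (real i + l)) *\<^sub>R (ident * (D ^^ i) g) +
     (real i * (real i - 1 + 2 * l)) *\<^sub>R (D ^^ (i - 1)) g"
proof (induction i)
  case (Suc i)
  have *: "D ((real i * r) *\<^sub>R (D ^^ (i - 1)) g) = (real i * r) *\<^sub>R (D ^^ i) g" for r
    by (cases i) (auto simp: D_scaleR D_zero)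
  show ?case
    by (simp only: funpow.simps comp_apply Suc D_add *,
        simp only: D_mult D_scaleR D_ident D_ident_sq funpow.simps comp_apply diff_Suc_1)
       (simp add: smooth_fun_eq_iff app_simps algebra_simps)
qed simp

lift_definition coeff_op :: "nat \<Rightarrow> (nat \<Rightarrow> smooth_fun) \<Rightarrow> diff_op"
  is "\<lambda>n a g. \<Sum>i\<le>n. a i * (D ^^ i) g"
  unfolding is_diff_op_def by blast

lemma diff_op_eq_iff: "A = B \<longleftrightarrow> (\<forall>g. op_app A g = op_app B g)"
  by (simp add: op_app_inject[symmetric] fun_eq_iff)

lemma coeff_op_cong: "(\<And>k. k \<le> n \<Longrightarrow> a k = b k) \<Longrightarrow> coeff_op n a = coeff_op n b"
  by transfer (auto intro!: sum.cong)

lemma coeff_op_zero [simp]: "coeff_op n (\<lambda>k. 0) = 0"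
  by (simp add: diff_op_eq_iff coeff_op.rep_eq zero_diff_op.rep_eq)

lemma coeff_op_extend:
  assumes "n \<le> N" "\<And>k. k > n \<Longrightarrow> a k = 0"
  shows "coeff_op n a = coeff_op N a"
  unfolding diff_op_eq_iff coeff_op.rep_eq
  by (intro allI sum.mono_neutral_left) (use assms in auto)

lemma coeff_op_exists:
  obtains n a where "\<And>m. m \<ge> n \<Longrightarrow> A = coeff_op m a" "\<And>k. k > n \<Longrightarrow> a k = 0"
proof -
  obtain n a where A: "\<And>g. op_app A g = (\<Sum>i\<le>n. a i * (D ^^ i) g)"
    using op_app[of A] unfolding is_diff_op_def by blast
  define b where "b i = (if i \<le> n then a i else 0)" for i
  have "A = coeff_op m b" if "m \<ge> n" for m
    unfolding op_app_inject[symmetric] coeff_op.rep_eq A fun_eq_iff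
    by (intro allI sum.mono_neutral_cong_left) (use that in \<open>auto simp: b_def\<close>)
  then show ?thesis
    using that[of n b] by (simp add: b_def)
qed

lemma D_pow_ident_pow: "(D ^^ i) (ident ^ i) = fact i *\<^sub>R 1"
  and D_pow_ident_pow_less: "i < j \<Longrightarrow> (D ^^ j) (ident ^ i) = 0"
proof -
  have D: "D (ident ^ Suc i) = real (Suc i) *\<^sub>R ident ^ i" for i
  proof (induction i)
    case (Suc i)
    then show ?case
      by (simp only: power_Suc[of _ "Suc i"] D_mult D_ident) (simp add: smooth_fun_eq_iff app_simps algebra_simps)
  qed (simp add: D_ident)
  have *: "(D ^^ i) (ident ^ i) = fact i *\<^sub>R 1" for i
  proof (induction i)
    case (Suc i)
    show ?case
      by (simp only: funpow_Suc_right comp_apply D D_pow_scaleR Suc) (simp add: algebra_simps)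
  qed simp
  then show "(D ^^ i) (ident ^ i) = fact i *\<^sub>R 1" .
  have z: "(D ^^ k) 0 = 0" for k
    by (induction k) (auto simp: D_zero)
  assume "i < j"
  then obtain k where k: "j = k + Suc i"
    by (metis add.commute less_imp_Suc_add add_Suc_right)
  show "(D ^^ j) (ident ^ i) = 0"
    unfolding k funpow_add by (simp add: * D_scaleR D_one z)
qed

lemma coeff_op_zeroD:
  assumes "coeff_op n a = 0" "k \<le> n"
  shows "a k = 0"
  using \<open>k \<le> n\<close>
proof (induction k rule: less_induct)
  case (less k)
  have "(\<Sum>i\<le>n. a i * (D ^^ i) (ident ^ k)) = 0"
    using assms(1) by (simp add: diff_op_eq_iff coeff_op.rep_eq zero_diff_op.rep_eq)
  also have "(\<Sum>i\<le>n. a i * (D ^^ i) (ident ^ k)) = (\<Sum>i\<le>n. if i = k then fact k *\<^sub>R a k else 0)"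
  proof (intro sum.cong refl)
    fix i
    assume "i \<in> {..n}"
    then show "a i * (D ^^ i) (ident ^ k) = (if i = k then fact k *\<^sub>R a k else 0)"
      using less.IH[of i] by (cases i k rule: linorder_cases)
        (auto simp: D_pow_ident_pow D_pow_ident_pow_less)
  qed
  finally show ?case
    using less.prems by simp
qed

lemma coeff_op_minus: "coeff_op n a - coeff_op n b = coeff_op n (\<lambda>k. a k - b k)"
  by (simp add: diff_op_eq_iff coeff_op.rep_eq minus_diff_op.rep_eq left_diff_distrib sum_subtractf)

lemma coeff_op_scaleR: "r *\<^sub>R coeff_op n a = coeff_op n (\<lambda>k. r *\<^sub>R a k)"
  by (simp add: diff_op_eq_iff coeff_op.rep_eq scaleR_diff_op.rep_eq scaleR_sum_right)

lemma coeff_op_eqD: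
  assumes "coeff_op n a = coeff_op n b" "k \<le> n"
  shows "a k = b k"
proof -
  have "coeff_op n (\<lambda>k. a k - b k) = 0"
    using assms(1) coeff_op_minus[of n a b] by simp
  from coeff_op_zeroD[OF this assms(2)] show ?thesis by simp
qed

lemma lie_diff_op_1:
  "lie_diff_op l m 1 (coeff_op n a) = coeff_op n (\<lambda>k. D (a k))"
proof -
  have "lie_density m 1 (\<Sum>i\<le>n. a i * (D ^^ i) g) - (\<Sum>i\<le>n. a i * (D ^^ i) (lie_density l 1 g)) =
      (\<Sum>i\<le>n. D (a i) * (D ^^ i) g)" for g
    unfolding lie_density_1 D_sum sum_subtractf[symmetric]
    by (intro sum.cong refl) (simp add: D_mult funpow_swap1[of D] del: funpow.simps)
  then show ?thesis
    by (simp only: diff_op_eq_iff lie_diff_op.rep_eq coeff_op.rep_eq) simp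
qed

lemma lie_diff_op_ident:
  "lie_diff_op l m ident (coeff_op n a) =
     coeff_op n (\<lambda>k. ident * D (a k) + (m - l - real k) *\<^sub>R a k)"
proof -
  have "lie_density m ident (\<Sum>i\<le>n. a i * (D ^^ i) g) =
      (\<Sum>i\<le>n. lie_density m ident (a i * (D ^^ i) g))" for g
    by (simp add: lie_density_def D_sum sum_distrib_left sum.distrib scaleR_sum_right)
  moreover have "lie_density m ident (a i * (D ^^ i) g) - a i * (D ^^ i) (lie_density l ident g) =
      (ident * D (a i) + (m - l - real i) *\<^sub>R a i) * (D ^^ i) g" for i g
    unfolding D_pow_lie_density_ident unfolding lie_density_ident
    by (simp add: D_mult smooth_fun_eq_iff app_simps algebra_simps)
  ultimately have "lie_density m ident (\<Sum>i\<le>n. a i * (D ^^ i) g) -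
      (\<Sum>i\<le>n. a i * (D ^^ i) (lie_density l ident g)) =
      (\<Sum>i\<le>n. (ident * D (a i) + (m - l - real i) *\<^sub>R a i) * (D ^^ i) g)" for g
    by (simp only: sum_subtractf[symmetric])
  then show ?thesis
    by (simp only: diff_op_eq_iff lie_diff_op.rep_eq coeff_op.rep_eq) simp
qed

lemma lie_diff_op_ident_sq:
  assumes "a (Suc n) = 0"
  shows "lie_diff_op l m (ident\<^sup>2) (coeff_op n a) =
     coeff_op n (\<lambda>k. ident\<^sup>2 * D (a k) + (2 * (m - l - real k)) *\<^sub>R (ident * a k) -
       ((real k + 1) * (real k + 2 * l)) *\<^sub>R a (Suc k))"
proof -
  have "lie_density m (ident\<^sup>2) (\<Sum>i\<le>n. a i * (D ^^ i) g) -
      (\<Sum>i\<le>n. a i * (D ^^ i) (lie_density l (ident\<^sup>2) g)) =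
      (\<Sum>i\<le>n. (ident\<^sup>2 * D (a i) + (2 * (m - l - real i)) *\<^sub>R (ident * a i) -
        ((real i + 1) * (real i + 2 * l)) *\<^sub>R a (Suc i)) * (D ^^ i) g)" for g
  proof -
    let ?b = "\<lambda>i. (real i * (real i - 1 + 2 * l)) *\<^sub>R (a i * (D ^^ (i - 1)) g)"
    let ?c = "\<lambda>i. (ident\<^sup>2 * D (a i) + (2 * (m - l - real i)) *\<^sub>R (ident * a i)) * (D ^^ i) g"
    have "(\<Sum>i\<le>n. ?b i) = (\<Sum>i\<le>Suc n. ?b i)"
      using assms by simp
    also have "\<dots> = (\<Sum>i\<le>n. ?b (Suc i))"
      by (subst sum.atMost_Suc_shift) simp
    finally have b: "(\<Sum>i\<le>n. ?b i) = (\<Sum>i\<le>n. ?b (Suc i))" .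
    have "lie_density m (ident\<^sup>2) (\<Sum>i\<le>n. a i * (D ^^ i) g) =
        (\<Sum>i\<le>n. lie_density m (ident\<^sup>2) (a i * (D ^^ i) g))"
      by (simp add: lie_density_def D_sum sum_distrib_left sum.distrib scaleR_sum_right)
    then have "lie_density m (ident\<^sup>2) (\<Sum>i\<le>n. a i * (D ^^ i) g) -
        (\<Sum>i\<le>n. a i * (D ^^ i) (lie_density l (ident\<^sup>2) g)) =
        (\<Sum>i\<le>n. lie_density m (ident\<^sup>2) (a i * (D ^^ i) g) -
          a i * (D ^^ i) (lie_density l (ident\<^sup>2) g))"
      by (simp only: sum_subtractf)
    also have "\<dots> = (\<Sum>i\<le>n. ?c i - ?b i)"
    proof (rule sum.cong)
      fix i
      show "lie_density m (ident\<^sup>2) (a i * (D ^^ i) g) -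
          a i * (D ^^ i) (lie_density l (ident\<^sup>2) g) = ?c i - ?b i"
        unfolding D_pow_lie_density_ident_sq unfolding lie_density_ident_sq
        by (simp add: D_mult smooth_fun_eq_iff app_simps algebra_simps)
    qed simp
    also have "\<dots> = (\<Sum>i\<le>n. ?c i - ?b (Suc i))"
      by (simp only: sum_subtractf b)
    finally show ?thesis
      by (simp add: algebra_simps)
  qed
  then show ?thesis
    by (simp only: diff_op_eq_iff lie_diff_op.rep_eq coeff_op.rep_eq) simp
qed

lemma lie_diff_op_1_surj: "\<exists>B. lie_diff_op l m 1 B = A"
proof -
  obtain n a where A: "A = coeff_op n a"
    by (meson coeff_op_exists order_refl)
  obtain b where "\<forall>k. D (b k) = a k"
    using choice[of "\<lambda>k g. D g = a k"] D_surj by blast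
  then show ?thesis
    unfolding A by (intro exI[of _ "coeff_op n b"]) (simp add: lie_diff_op_1)
qed

lemma lie_diff_op_1_eq_0:
  assumes "lie_diff_op l m 1 A = 0"
  obtains n c where "\<And>j. j \<ge> n \<Longrightarrow> A = coeff_op j (\<lambda>k. c k *\<^sub>R 1)" "\<And>k. k > n \<Longrightarrow> c k = 0"
proof -
  obtain n a where A: "\<And>j. j \<ge> n \<Longrightarrow> A = coeff_op j a" "\<And>k. k > n \<Longrightarrow> a k = 0"
    using coeff_op_exists by blast
  have "D (a k) = 0" for k
  proof (cases "k \<le> n")
    case True
    then show ?thesis
      using assms A(1)[of n] coeff_op_zeroD[of n "\<lambda>k. D (a k)"] by (simp add: lie_diff_op_1)
  qed (use A(2) in \<open>auto simp: D_zero\<close>)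
  then obtain c where "\<And>k. a k = c k *\<^sub>R 1"
    using choice[of "\<lambda>k c. a k = c *\<^sub>R 1"] D_eq_0_imp_const by blast
  moreover from this have "a = (\<lambda>k. c k *\<^sub>R 1)" by auto
  ultimately show ?thesis
    using A that[of n c] by simp
qed

lemma lie_diff_op_1_eq_const:
  assumes "lie_diff_op l m 1 A = 2 *\<^sub>R coeff_op n (\<lambda>k. c k *\<^sub>R 1)" "\<And>k. k > n \<Longrightarrow> c k = 0"
  obtains N d where "N \<ge> n" "A = coeff_op N (\<lambda>k. (2 * c k) *\<^sub>R ident + d k *\<^sub>R 1)"
     "\<And>k. k > N \<Longrightarrow> d k = 0"
proof -
  obtain N0 a where A: "\<And>j. j \<ge> N0 \<Longrightarrow> A = coeff_op j a" "\<And>k. k > N0 \<Longrightarrow> a k = 0"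
    using coeff_op_exists by blast
  define N where "N = max n N0"
  have "D (a k - (2 * c k) *\<^sub>R ident) = 0" for k
  proof (cases "k \<le> N")
    case True
    have "coeff_op n (\<lambda>k. c k *\<^sub>R 1) = coeff_op N (\<lambda>k. c k *\<^sub>R 1)"
      by (rule coeff_op_extend) (auto simp: N_def assms(2))
    then have "coeff_op N (\<lambda>k. D (a k)) = coeff_op N (\<lambda>k. (2 * c k) *\<^sub>R 1)"
      using assms A(1)[of N] by (simp add: lie_diff_op_1 coeff_op_scaleR N_def)
    from coeff_op_eqD[OF this True] show ?thesis
      by (simp add: D_minus D_scaleR D_ident)
  qed (use A(2) assms(2) in \<open>auto simp: D_zero N_def\<close>)
  then obtain d where d: "\<And>k. a k - (2 * c k) *\<^sub>R ident = d k *\<^sub>R 1"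
    using choice[of "\<lambda>k d. a k - (2 * c k) *\<^sub>R ident = d *\<^sub>R 1"] D_eq_0_imp_const by blast
  then have "a = (\<lambda>k. (2 * c k) *\<^sub>R ident + d k *\<^sub>R 1)"
    by (auto simp: algebra_simps)
  moreover have "d k = 0" if "k > N" for k
    using d[of k] A(2)[of k] assms(2)[of k] that by (simp add: N_def)
  ultimately show ?thesis
    using A(1)[of N] that[of N d] by (simp add: N_def)
qed

lemma lie_diff_op_const:
  "lie_diff_op l m 1 (coeff_op n (\<lambda>k. c k *\<^sub>R 1)) = 0"
  "lie_diff_op l m ident (coeff_op n (\<lambda>k. c k *\<^sub>R 1)) =
    coeff_op n (\<lambda>k. ((m - l - real k) * c k) *\<^sub>R 1)"
  "c (Suc n) = 0 \<Longrightarrow> lie_diff_op l m (ident\<^sup>2) (coeff_op n (\<lambda>k. c k *\<^sub>R 1)) =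
    coeff_op n (\<lambda>k. (2 * (m - l - real k) * c k) *\<^sub>R ident -
      ((real k + 1) * (real k + 2 * l) * c (Suc k)) *\<^sub>R 1)"
proof -
  show "lie_diff_op l m 1 (coeff_op n (\<lambda>k. c k *\<^sub>R 1)) = 0"
    by (simp add: lie_diff_op_1 D_scaleR D_one)
  show "lie_diff_op l m ident (coeff_op n (\<lambda>k. c k *\<^sub>R 1)) =
      coeff_op n (\<lambda>k. ((m - l - real k) * c k) *\<^sub>R 1)"
    by (simp add: lie_diff_op_ident D_scaleR D_one)
  assume "c (Suc n) = 0"
  then show "lie_diff_op l m (ident\<^sup>2) (coeff_op n (\<lambda>k. c k *\<^sub>R 1)) =
    coeff_op n (\<lambda>k. (2 * (m - l - real k) * c k) *\<^sub>R ident -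
      ((real k + 1) * (real k + 2 * l) * c (Suc k)) *\<^sub>R 1)"
    by (simp add: lie_diff_op_ident_sq D_scaleR D_one)
qed

lemma lie_diff_op_affine:
  assumes "p (Suc n) = 0"
  shows "lie_diff_op l m ident (coeff_op n (\<lambda>k. (2 * p k) *\<^sub>R ident + q k *\<^sub>R 1)) -
      lie_diff_op l m (ident\<^sup>2) (coeff_op n (\<lambda>k. p k *\<^sub>R 1)) -
      coeff_op n (\<lambda>k. (2 * p k) *\<^sub>R ident + q k *\<^sub>R 1) =
    coeff_op n (\<lambda>k. ((m - l - real k - 1) * q k +
      (real k + 1) * (real k + 2 * l) * p (Suc k)) *\<^sub>R 1)"
  unfolding lie_diff_op_ident lie_diff_op_const(3)[of p n l m, OF assms] coeff_op_minus
proof (rule coeff_op_cong)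
  fix k
  show "ident * D ((2 * p k) *\<^sub>R ident + q k *\<^sub>R 1) +
      (m - l - real k) *\<^sub>R ((2 * p k) *\<^sub>R ident + q k *\<^sub>R 1) -
      ((2 * (m - l - real k) * p k) *\<^sub>R ident -
       ((real k + 1) * (real k + 2 * l) * p (Suc k)) *\<^sub>R 1) -
      ((2 * p k) *\<^sub>R ident + q k *\<^sub>R 1) =
      ((m - l - real k - 1) * q k + (real k + 1) * (real k + 2 * l) * p (Suc k)) *\<^sub>R 1"
    unfolding smooth_fun_eq_iff D_add D_scaleR D_one D_ident app_simps
    by algebra
qed

section \<open>Cocycles of differential operators that vanish on \<open>d/dt\<close>\<close>

text \<open>On operators with constant coefficients \<open>t d/dt\<close> multiplies \<open>D\<^sup>k\<close> by \<open>m - l - k\<close>, and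
  the lowering part of \<open>t\<^sup>2 d/dt\<close> maps \<open>D\<^sup>k\<^sup>+\<^sup>1\<close> to \<open>- (k + 1) (k + 2 l) D\<^sup>k\<close>. The second condition
  says that the weight zero operator \<open>D\<^sup>k\<^sup>+\<^sup>1\<close>, if there is one, is not annihilated.\<close>

definition nonresonant :: "real \<Rightarrow> real \<Rightarrow> bool" where
  "nonresonant l m \<longleftrightarrow> m \<noteq> l \<and> (\<forall>k. m - l = real k + 1 \<longrightarrow> real k + 2 * l \<noteq> 0)"

lemma invariant_eq_0:
  assumes "nonresonant l m"
    and A: "lie_diff_op l m 1 A = 0" "lie_diff_op l m ident A = 0" "lie_diff_op l m (ident\<^sup>2) A = 0"
  shows "A = 0"
proof -
  obtain n c where n: "\<And>j. j \<ge> n \<Longrightarrow> A = coeff_op j (\<lambda>k. c k *\<^sub>R 1)" "\<And>k. k > n \<Longrightarrow> c k = 0"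
    using lie_diff_op_1_eq_0[OF A(1)] by blast
  have h: "(m - l - real k) * c k = 0" for k
  proof (cases "k \<le> n")
    case True
    have "coeff_op n (\<lambda>k. ((m - l - real k) * c k) *\<^sub>R 1) = 0"
      using A(2) n(1)[OF order_refl] lie_diff_op_const(2) by metis
    then show ?thesis
      using coeff_op_zeroD[OF _ True] by fastforce
  qed (use n in auto)
  have f: "(real k + 1) * (real k + 2 * l) * c (Suc k) = 0" for k
  proof (cases "k \<le> n")
    case True
    have "coeff_op n (\<lambda>k. (2 * (m - l - real k) * c k) *\<^sub>R ident -
        ((real k + 1) * (real k + 2 * l) * c (Suc k)) *\<^sub>R 1) = 0"
      using A(3) n(1)[OF order_refl] lie_diff_op_const(3)[of c n l m] n(2)[of "Suc n"] by simp
    from coeff_op_zeroD[OF this True]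
    have "(2 * (m - l - real k) * c k) *\<^sub>R ident -
        ((real k + 1) * (real k + 2 * l) * c (Suc k)) *\<^sub>R 1 = 0" .
    moreover have "2 * (m - l - real k) * c k = 0"
      using h[of k] by auto
    ultimately show ?thesis
      by (simp only: scaleR_zero_left) simp
  qed (use n in auto)
  have "c k = 0" for k
  proof (rule ccontr)
    assume k: "c k \<noteq> 0"
    then have "m - l = real k" using h[of k] by simp
    with k assms(1) f[of "k - 1"] show False
      by (cases k) (auto simp: nonresonant_def)
  qed
  then show ?thesis
    using n(1)[OF order_refl] by simp
qed

lemma invariant_1_cocycle:
  assumes "nonresonant l m"
    and P: "lie_diff_op l m 1 P = 0"
    and Q: "lie_diff_op l m 1 Q = 2 *\<^sub>R P"
    and PQ: "lie_diff_op l m ident Q - lie_diff_op l m (ident\<^sup>2) P = Q"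
  shows "\<exists>B. lie_diff_op l m 1 B = 0 \<and> lie_diff_op l m ident B = P \<and> lie_diff_op l m (ident\<^sup>2) B = Q"
proof -
  obtain n p where n: "\<And>j. j \<ge> n \<Longrightarrow> P = coeff_op j (\<lambda>k. p k *\<^sub>R 1)" "\<And>k. k > n \<Longrightarrow> p k = 0"
    using lie_diff_op_1_eq_0[OF P] by blast
  have "lie_diff_op l m 1 Q = 2 *\<^sub>R coeff_op n (\<lambda>k. p k *\<^sub>R 1)"
    using Q n(1)[of n] by simp
  from lie_diff_op_1_eq_const[OF this n(2)]
  obtain N0 q where N0: "N0 \<ge> n" "Q = coeff_op N0 (\<lambda>k. (2 * p k) *\<^sub>R ident + q k *\<^sub>R 1)"
      "\<And>k. k > N0 \<Longrightarrow> q k = 0"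
    by blast
  define N where "N = Suc N0"
  have QN: "Q = coeff_op N (\<lambda>k. (2 * p k) *\<^sub>R ident + q k *\<^sub>R 1)"
    unfolding N0(2) by (rule coeff_op_extend) (use N0(1,3) n(2) in \<open>auto simp: N_def\<close>)
  have PN: "P = coeff_op N (\<lambda>k. p k *\<^sub>R 1)"
    by (rule n(1)) (use N0(1) in \<open>simp add: N_def\<close>)
  have pN: "p (Suc N) = 0"
    using n(2) N0(1) by (simp add: N_def)
  have rel: "(m - l - real k - 1) * q k + (real k + 1) * (real k + 2 * l) * p (Suc k) = 0" for k
  proof (cases "k \<le> N")
    case True
    have "coeff_op N (\<lambda>k. ((m - l - real k - 1) * q k +
      (real k + 1) * (real k + 2 * l) * p (Suc k)) *\<^sub>R 1) = 0"
      using PQ lie_diff_op_affine[of p N l m q, OF pN] by (simp flip: PN QN)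
    then show ?thesis
      using coeff_op_zeroD[OF _ True] by fastforce
  qed (use N0 n in \<open>auto simp: N_def\<close>)
  define w where "w k = (if m - l = real k
    then - q (k - 1) / (real k * (real k - 1 + 2 * l)) else p k / (m - l - real k))" for k
  have w0: "w (Suc N) = 0"
    using N0(1,3) n(2) by (auto simp: w_def N_def)
  have 1: "(m - l - real k) * w k = p k" for k
  proof (cases "m - l = real k")
    case True
    then obtain j where "k = Suc j"
      using assms(1) by (cases k) (auto simp: nonresonant_def)
    with True rel[of j] assms(1) show ?thesis
      by (auto simp: nonresonant_def)
  qed (auto simp: w_def)
  have 2: "- ((real k + 1) * (real k + 2 * l) * w (Suc k)) = q k" for k
  proof (cases "m - l = real (Suc k)")
    case True
    with assms(1) have "real k + 2 * l \<noteq> 0" by (auto simp: nonresonant_def)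
    then have "(real k + 1) * (real k + 2 * l) \<noteq> 0" by simp
    with True show ?thesis
      by (auto simp: w_def add.commute)
  next
    case False
    then have "m - l - real k - 1 \<noteq> 0" by simp
    with False rel[of k] show ?thesis
      by (simp add: w_def divide_simps) (simp add: algebra_simps)
  qed
  have "lie_diff_op l m (ident\<^sup>2) (coeff_op N (\<lambda>k. w k *\<^sub>R 1)) = Q"
    unfolding lie_diff_op_const(3)[of w N l m, OF w0] QN
    by (rule coeff_op_cong) (simp only: mult.assoc[of 2] 1, simp add: 2[symmetric])
  then show ?thesis
    by (intro exI[of _ "coeff_op N (\<lambda>k. w k *\<^sub>R 1)"]) (simp add: lie_diff_op_const 1 PN)
qed

lemma invariant_2_cocycle:
  assumes "nonresonant l m"
    and G: "lie_diff_op l m 1 G = 0"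
  shows "\<exists>P Q. lie_diff_op l m 1 P = 0 \<and> lie_diff_op l m 1 Q = 2 *\<^sub>R P \<and>
    lie_diff_op l m ident Q - lie_diff_op l m (ident\<^sup>2) P - Q = G"
proof -
  obtain n0 g where n: "\<And>j. j \<ge> n0 \<Longrightarrow> G = coeff_op j (\<lambda>k. g k *\<^sub>R 1)" "\<And>k. k > n0 \<Longrightarrow> g k = 0"
    using lie_diff_op_1_eq_0[OF G] by blast
  define n where "n = Suc n0"
  define p where "p k = (if m - l = real k
    then g (k - 1) / (real k * (real k - 1 + 2 * l)) else 0)" for k
  define q where "q k = (if m - l = real (Suc k) then 0 else g k / (m - l - real (Suc k)))" for k
  have "p (Suc n) = 0"
    using n(2) by (simp add: p_def n_def)
  note * = lie_diff_op_affine[of p n l m q, OF this]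
  have "(m - l - real k - 1) * q k + (real k + 1) * (real k + 2 * l) * p (Suc k) = g k" for k
  proof (cases "m - l = real (Suc k)")
    case True
    with assms(1) have "real k + 2 * l \<noteq> 0" by (auto simp: nonresonant_def)
    then have "(real k + 1) * (real k + 2 * l) \<noteq> 0" by simp
    with True show ?thesis
      by (auto simp: p_def q_def add.commute)
  next
    case False
    then have "m - l - real k - 1 \<noteq> 0" by simp
    with False show ?thesis
      by (simp add: p_def q_def divide_simps)
  qed
  then have "lie_diff_op l m ident (coeff_op n (\<lambda>k. (2 * p k) *\<^sub>R ident + q k *\<^sub>R 1)) -
      lie_diff_op l m (ident\<^sup>2) (coeff_op n (\<lambda>k. p k *\<^sub>R 1)) -
      coeff_op n (\<lambda>k. (2 * p k) *\<^sub>R ident + q k *\<^sub>R 1) = G"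
    unfolding * using n(1)[of n] by (simp add: n_def)
  moreover have "lie_diff_op l m 1 (coeff_op n (\<lambda>k. (2 * p k) *\<^sub>R ident + q k *\<^sub>R 1)) =
      2 *\<^sub>R coeff_op n (\<lambda>k. p k *\<^sub>R 1)"
    by (simp add: lie_diff_op_1 D_add D_scaleR D_ident D_one coeff_op_scaleR)
  ultimately show ?thesis
    using lie_diff_op_const(1) by blast
qed

section \<open>Cochains of low degree on \<open>sl\<^sub>2\<close>\<close>

definition coord0 :: "smooth_fun \<Rightarrow> real" where "coord0 X = app X 0"
definition coord1 :: "smooth_fun \<Rightarrow> real" where "coord1 X = app (D X) 0"
definition coord2 :: "smooth_fun \<Rightarrow> real" where "coord2 X = app (D (D X)) 0 / 2"

lemmas coord_defs = coord0_def coord1_def coord2_def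

lemma coord_linear [simp]:
  "coord0 (X + Y) = coord0 X + coord0 Y" "coord0 (r *\<^sub>R X) = r * coord0 X"
  "coord1 (X + Y) = coord1 X + coord1 Y" "coord1 (r *\<^sub>R X) = r * coord1 X"
  "coord2 (X + Y) = coord2 X + coord2 Y" "coord2 (r *\<^sub>R X) = r * coord2 X"
  by (simp_all add: coord_defs D_add D_scaleR plus_smooth_fun.rep_eq scaleR_smooth_fun.rep_eq
      add_divide_distrib)

lemma coord_basis [simp]:
  "coord0 1 = 1" "coord0 ident = 0" "coord0 (ident\<^sup>2) = 0"
  "coord1 1 = 0" "coord1 ident = 1" "coord1 (ident\<^sup>2) = 0"
  "coord2 1 = 0" "coord2 ident = 0" "coord2 (ident\<^sup>2) = 1"
  by (simp_all add: coord_defs D_one D_zero D_ident D_ident_sq D_scaleR zero_smooth_fun.rep_eq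
      one_smooth_fun.rep_eq ident.rep_eq scaleR_smooth_fun.rep_eq)
     (simp add: power2_eq_square times_smooth_fun.rep_eq ident.rep_eq)

lemma sl2_coord:
  assumes "X \<in> sl2"
  shows "X = coord0 X *\<^sub>R 1 + coord1 X *\<^sub>R ident + coord2 X *\<^sub>R ident\<^sup>2"
  using assms by (auto simp: sl2_iff)

lemma basis_in_sl2 [simp]: "1 \<in> sl2" "ident \<in> sl2" "ident\<^sup>2 \<in> sl2"
  by (simp_all add: sl2_def span_base)

lemma sl2_lincomb: "X \<in> sl2 \<Longrightarrow> Y \<in> sl2 \<Longrightarrow> a *\<^sub>R X + b *\<^sub>R Y \<in> sl2"
  by (simp add: sl2_def span_add span_scale)

lemma vf_bracket_basis [simp]:
  "vf_bracket 1 ident = 1" "vf_bracket 1 (ident\<^sup>2) = 2 *\<^sub>R ident" "vf_bracket ident (ident\<^sup>2) = ident\<^sup>2"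
  by (simp_all add: vf_bracket_def D_one D_ident D_ident_sq)
     (simp add: power2_eq_square scaleR_2)

lemma coord_bracket:
  assumes "X \<in> sl2" "Y \<in> sl2"
  shows "coord0 (vf_bracket X Y) = coord0 X * coord1 Y - coord0 Y * coord1 X"
    "coord1 (vf_bracket X Y) = 2 * (coord0 X * coord2 Y - coord0 Y * coord2 X)"
    "coord2 (vf_bracket X Y) = coord1 X * coord2 Y - coord1 Y * coord2 X"
proof -
  have DDD: "D (D (D Z)) = 0" if "Z \<in> sl2" for Z
    by (subst sl2_coord[OF that]) (simp add: D_add D_scaleR D_one D_ident D_ident_sq D_zero)
  show "coord0 (vf_bracket X Y) = coord0 X * coord1 Y - coord0 Y * coord1 X"
    "coord1 (vf_bracket X Y) = 2 * (coord0 X * coord2 Y - coord0 Y * coord2 X)"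
    "coord2 (vf_bracket X Y) = coord1 X * coord2 Y - coord1 Y * coord2 X"
    by (simp_all add: coord_defs vf_bracket_def D_minus D_add D_mult DDD assms plus_smooth_fun.rep_eq
        minus_smooth_fun.rep_eq times_smooth_fun.rep_eq field_simps)
qed

lemma CE_cochains_off: "c \<in> CE_cochains L u \<Longrightarrow> \<not> (length xs = u \<and> set xs \<subseteq> L) \<Longrightarrow> c xs = 0"
  unfolding CE_cochains_def by blast

lemma CE_cochains_linear:
  "c \<in> CE_cochains L u \<Longrightarrow> length xs = u \<Longrightarrow> set xs \<subseteq> L \<Longrightarrow> i < u \<Longrightarrow> x \<in> L \<Longrightarrow> y \<in> L \<Longrightarrow>
    c (xs[i := a *\<^sub>R x + b *\<^sub>R y]) = a *\<^sub>R c (xs[i := x]) + b *\<^sub>R c (xs[i := y])"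
  unfolding CE_cochains_def by blast

lemma CE_cochains_alt:
  "c \<in> CE_cochains L u \<Longrightarrow> length xs = u \<Longrightarrow> set xs \<subseteq> L \<Longrightarrow> i < j \<Longrightarrow> j < u \<Longrightarrow> xs ! i = xs ! j \<Longrightarrow>
    c xs = 0"
  unfolding CE_cochains_def by blast

lemma set_list_update_subset: "set xs \<subseteq> L \<Longrightarrow> x \<in> L \<Longrightarrow> set (xs[i := x]) \<subseteq> L"
  using set_update_subset_insert[of xs i x] by blast

lemma CE_cochains_swap:
  assumes c: "c \<in> CE_cochains L u" and L: "x + y \<in> L" "x \<in> L" "y \<in> L"
    and xs: "length xs = u" "set xs \<subseteq> L" "i < j" "j < u"
  shows "c (xs[i := x, j := y]) = - c (xs[i := y, j := x])"
proof -
  note set_list_update_subset[simp]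
  have lin: "c (zs[k := x + y]) = c (zs[k := x]) + c (zs[k := y])"
    if "length zs = u" "set zs \<subseteq> L" "k < u" for zs k
    using CE_cochains_linear[OF c, of zs k x y 1 1] that L by simp
  have z: "c (xs[i := z, j := z]) = 0" if "z \<in> L" for z
    by (rule CE_cochains_alt[OF c, of _ i j]) (use xs L that in auto)
  have 1: "c (xs[i := z, j := w]) = c (xs[j := w, i := z])" for z w
    using xs by (simp add: list_update_swap)
  have "0 = c (xs[i := x + y, j := x + y])"
    using z L by simp
  also have "\<dots> = c (xs[j := x, i := x + y]) + c (xs[j := y, i := x + y])"
    using xs L by (subst lin) (auto simp: 1)
  also have "\<dots> = c (xs[i := x, j := y]) + c (xs[i := y, j := x])"
    using xs L by (subst (1 2) lin) (auto simp: z simp flip: 1)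
  finally show ?thesis
    by (simp add: eq_neg_iff_add_eq_0)
qed

lemma CE_cochains_expand:
  assumes c: "c \<in> CE_cochains sl2 u" and xs: "length xs = u" "set xs \<subseteq> sl2" "i < u"
    and x: "x \<in> sl2"
  shows "c (xs[i := x]) = coord0 x *\<^sub>R c (xs[i := 1]) + coord1 x *\<^sub>R c (xs[i := ident]) +
    coord2 x *\<^sub>R c (xs[i := ident\<^sup>2])"
proof -
  have "x = 1 *\<^sub>R (coord0 x *\<^sub>R 1 + coord1 x *\<^sub>R ident) + coord2 x *\<^sub>R ident\<^sup>2"
    using sl2_coord[OF x] by simp
  then have "c (xs[i := x]) = c (xs[i := 1 *\<^sub>R (coord0 x *\<^sub>R 1 + coord1 x *\<^sub>R ident) + coord2 x *\<^sub>R ident\<^sup>2])"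
    by simp
  also have "\<dots> = 1 *\<^sub>R c (xs[i := coord0 x *\<^sub>R 1 + coord1 x *\<^sub>R ident]) + coord2 x *\<^sub>R c (xs[i := ident\<^sup>2])"
    using xs by (intro CE_cochains_linear[OF c]) (auto intro: sl2_lincomb)
  also have "c (xs[i := coord0 x *\<^sub>R 1 + coord1 x *\<^sub>R ident]) =
      coord0 x *\<^sub>R c (xs[i := 1]) + coord1 x *\<^sub>R c (xs[i := ident])"
    using xs by (intro CE_cochains_linear[OF c]) auto
  finally show ?thesis by simp
qed

lemma CE_cochains_sl2_ge_4:
  assumes c: "c \<in> CE_cochains sl2 u" and u: "u \<ge> 4"
  shows "c = (\<lambda>xs. 0)"
proof
  fix xs
  have *: "\<forall>xs. length xs = u \<longrightarrow> set xs \<subseteq> sl2 \<longrightarrow>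
      (\<forall>i<m. xs ! i \<in> {1, ident, ident\<^sup>2}) \<longrightarrow> c xs = 0" if "m \<le> 4" for m
    using that
  proof (induction rule: inc_induct)
    case base
    show ?case
    proof (intro allI impI)
      fix xs :: "smooth_fun list"
      assume xs: "length xs = u" "set xs \<subseteq> sl2" "\<forall>i<4. xs ! i \<in> {1, ident, ident\<^sup>2}"
      have "\<not> inj_on ((!) xs) {..<4::nat}"
      proof
        assume "inj_on ((!) xs) {..<4::nat}"
        then have "card {..<4::nat} \<le> card {1, ident, ident\<^sup>2}"
          by (rule card_inj_on_le) (use xs(3) in auto)
        also have "\<dots> \<le> 3"
          by (simp add: card_insert_if)
        finally show False by simp
      qed
      then obtain i j :: nat where "i < j" "j < 4" "xs ! i = xs ! j"
        unfolding inj_on_def by (metis lessThan_iff linorder_neqE_nat)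
      then show "c xs = 0"
        using CE_cochains_alt[OF c] xs u by fastforce
    qed
  next
    case (step m)
    show ?case
    proof (intro allI impI)
      fix xs :: "smooth_fun list"
      assume xs: "length xs = u" "set xs \<subseteq> sl2" "\<forall>i<m. xs ! i \<in> {1, ident, ident\<^sup>2}"
      have "c (xs[m := b]) = 0" if "b \<in> {1, ident, ident\<^sup>2}" for b
      proof -
        have "set (xs[m := b]) \<subseteq> sl2"
          using xs(2) that by (intro set_list_update_subset) auto
        moreover have "\<forall>i<Suc m. xs[m := b] ! i \<in> {1, ident, ident\<^sup>2}"
          using xs that step.hyps u by (auto simp: less_Suc_eq nth_list_update)
        ultimately show ?thesis
          using step.IH xs(1) by simp
      qed
      moreover have "m < u" "xs ! m \<in> sl2"
        using xs step.hyps u by auto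
      ultimately show "c xs = 0"
        using CE_cochains_expand[OF c xs(1,2), of m "xs ! m"] by simp
    qed
  qed
  show "c xs = 0"
    using *[of 0] CE_cochains_off[OF c] by auto
qed

lemma CE_cochains_sl2_1:
  assumes c: "c \<in> CE_cochains sl2 1" and "x \<in> sl2"
  shows "c [x] = coord0 x *\<^sub>R c [1] + coord1 x *\<^sub>R c [ident] + coord2 x *\<^sub>R c [ident\<^sup>2]"
  using CE_cochains_expand[OF c, of "[x]" 0 x] assms by simp

lemma CE_cochains_sl2_2:
  assumes c: "c \<in> CE_cochains sl2 2" and xy: "x \<in> sl2" "y \<in> sl2"
  shows "c [x, y] = (coord0 x * coord1 y - coord0 y * coord1 x) *\<^sub>R c [1, ident] +
    (coord0 x * coord2 y - coord0 y * coord2 x) *\<^sub>R c [1, ident\<^sup>2] +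
    (coord1 x * coord2 y - coord1 y * coord2 x) *\<^sub>R c [ident, ident\<^sup>2]"
proof -
  have z: "c [a, a] = 0" if "a \<in> sl2" for a
    using CE_cochains_alt[OF c, of "[a, a]" 0 1] that by simp
  have s: "c [a, b] = - c [b, a]" if "a \<in> sl2" "b \<in> sl2" for a b
    using CE_cochains_swap[OF c, of a b "[a, b]" 0 1] that sl2_lincomb[of a b 1 1] by simp
  have e1: "c [a, b] = coord0 a *\<^sub>R c [1, b] + coord1 a *\<^sub>R c [ident, b] + coord2 a *\<^sub>R c [ident\<^sup>2, b]"
    if "a \<in> sl2" "b \<in> sl2" for a b
    using CE_cochains_expand[OF c, of "[a, b]" 0 a] that by simp
  have e2: "c [a, b] = coord0 b *\<^sub>R c [a, 1] + coord1 b *\<^sub>R c [a, ident] + coord2 b *\<^sub>R c [a, ident\<^sup>2]"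
    if "a \<in> sl2" "b \<in> sl2" for a b
    using CE_cochains_expand[OF c, of "[a, b]" 1 b] that by simp
  note s' = s[of ident 1] s[of "ident\<^sup>2" 1] s[of "ident\<^sup>2" ident]
  show ?thesis
    by (simp add: e1[OF xy] e2[OF _ xy(2)] z s' algebra_simps)
qed

lemma CE_cochains_sl2_3:
  assumes c: "c \<in> CE_cochains sl2 3" and xyz: "x \<in> sl2" "y \<in> sl2" "z \<in> sl2"
  shows "c [x, y, z] = (coord0 x * (coord1 y * coord2 z - coord1 z * coord2 y)
      - coord0 y * (coord1 x * coord2 z - coord1 z * coord2 x)
      + coord0 z * (coord1 x * coord2 y - coord1 y * coord2 x)) *\<^sub>R c [1, ident, ident\<^sup>2]"
proof -
  have z: "c [a, a, b] = 0" "c [a, b, a] = 0" "c [b, a, a] = 0" if "a \<in> sl2" "b \<in> sl2" for a b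
    using CE_cochains_alt[OF c, of "[a, a, b]" 0 1] CE_cochains_alt[OF c, of "[a, b, a]" 0 2]
      CE_cochains_alt[OF c, of "[b, a, a]" 1 2] that by simp_all
  have s1: "c [a, b, d] = - c [b, a, d]" if "a \<in> sl2" "b \<in> sl2" "d \<in> sl2" for a b d
    using CE_cochains_swap[OF c, of a b "[a, b, d]" 0 1] that sl2_lincomb[of a b 1 1] by simp
  have s2: "c [d, a, b] = - c [d, b, a]" if "a \<in> sl2" "b \<in> sl2" "d \<in> sl2" for a b d
    using CE_cochains_swap[OF c, of a b "[d, a, b]" 1 2] that sl2_lincomb[of a b 1 1]
    by (simp add: numeral_2_eq_2)
  have e1: "c [x, y, z] = coord0 x *\<^sub>R c [1, y, z] + coord1 x *\<^sub>R c [ident, y, z] +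
      coord2 x *\<^sub>R c [ident\<^sup>2, y, z]"
    using CE_cochains_expand[OF c, of "[x, y, z]" 0 x] xyz by simp
  have e2: "c [a, y, z] = coord0 y *\<^sub>R c [a, 1, z] + coord1 y *\<^sub>R c [a, ident, z] +
      coord2 y *\<^sub>R c [a, ident\<^sup>2, z]" if "a \<in> sl2" for a
    using CE_cochains_expand[OF c, of "[a, y, z]" 1 y] xyz that by simp
  have e3: "c [a, b, z] = coord0 z *\<^sub>R c [a, b, 1] + coord1 z *\<^sub>R c [a, b, ident] +
      coord2 z *\<^sub>R c [a, b, ident\<^sup>2]" if "a \<in> sl2" "b \<in> sl2" for a b
    using CE_cochains_expand[OF c, of "[a, b, z]" 2 z] xyz that by (simp add: numeral_2_eq_2)
  note s' = s1[of ident 1 "ident\<^sup>2"] s1[of "ident\<^sup>2" 1 ident] s1[of "ident\<^sup>2" ident 1]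
    s2[of "ident\<^sup>2" ident 1] s2[of "ident\<^sup>2" 1 ident] 
  show ?thesis
    by (simp add: e1 e2 e3 z s' algebra_simps)
qed

lemma CE_cochains_0_I: "(\<lambda>xs. if xs = [] then w else 0) \<in> CE_cochains L 0"
  by (auto simp: CE_cochains_def)

lemma CE_cochains_1_I:
  assumes "\<And>x y a b. x \<in> L \<Longrightarrow> y \<in> L \<Longrightarrow> a *\<^sub>R x + b *\<^sub>R y \<in> L"
    "\<And>x y a b. x \<in> L \<Longrightarrow> y \<in> L \<Longrightarrow> f (a *\<^sub>R x + b *\<^sub>R y) = a *\<^sub>R f x + b *\<^sub>R f y"
  shows "(\<lambda>xs. if length xs = 1 \<and> set xs \<subseteq> L then f (xs ! 0) else 0) \<in> CE_cochains L 1"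
  (is "?c \<in> CE_cochains L _")
proof -
  have "?c (xs[i := a *\<^sub>R x + b *\<^sub>R y]) = a *\<^sub>R ?c (xs[i := x]) + b *\<^sub>R ?c (xs[i := y])"
    if xs: "x \<in> L" "y \<in> L" "length xs = 1" "i < 1" for xs i a b x y
  proof -
    obtain p where "xs = [p]"
      using xs(3) by (auto simp: length_Suc_conv)
    then show ?thesis
      using xs assms by simp
  qed
  then show ?thesis
    unfolding CE_cochains_def by (intro CollectI conjI allI ballI impI) (simp_all only: if_not_P, simp)
qed

lemma CE_cochains_2_I:
  assumes "\<And>x y a b. x \<in> L \<Longrightarrow> y \<in> L \<Longrightarrow> a *\<^sub>R x + b *\<^sub>R y \<in> L"
    "\<And>x y z a b. x \<in> L \<Longrightarrow> y \<in> L \<Longrightarrow> z \<in> L \<Longrightarrow> f (a *\<^sub>R x + b *\<^sub>R y) z = a *\<^sub>R f x z + b *\<^sub>R f y z"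
    "\<And>x y z a b. x \<in> L \<Longrightarrow> y \<in> L \<Longrightarrow> z \<in> L \<Longrightarrow> f z (a *\<^sub>R x + b *\<^sub>R y) = a *\<^sub>R f z x + b *\<^sub>R f z y"
    "\<And>x. x \<in> L \<Longrightarrow> f x x = 0"
  shows "(\<lambda>xs. if length xs = 2 \<and> set xs \<subseteq> L then f (xs ! 0) (xs ! 1) else 0) \<in> CE_cochains L 2"
  (is "?c \<in> CE_cochains L _")
proof -
  have lin: "?c (xs[i := a *\<^sub>R x + b *\<^sub>R y]) = a *\<^sub>R ?c (xs[i := x]) + b *\<^sub>R ?c (xs[i := y])"
    if xs: "x \<in> L" "y \<in> L" "length xs = 2" "set xs \<subseteq> L" "i < 2" for xs i a b x y
  proof -
    obtain p q where "xs = [p, q]"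
      using xs(3) by (auto simp: numeral_2_eq_2 length_Suc_conv)
    moreover have "i = 0 \<or> i = 1"
      using xs(5) by auto
    ultimately show ?thesis
      using xs assms by auto
  qed
  have alt: "?c xs = 0" if ij: "set xs \<subseteq> L" "length xs = 2" "i < j" "j < 2" "xs ! i = xs ! j" for xs i j
  proof -
    have "i = 0" "j = 1" using ij by auto
    moreover have "xs ! 1 \<in> L" using ij(1,2) by auto
    ultimately show ?thesis
      using ij(5) assms(4) by simp
  qed
  show ?thesis
    unfolding CE_cochains_def
    by (intro CollectI conjI allI ballI impI) (rule if_not_P, assumption, erule (4) lin, erule (4) alt)
qed

lemma CE_diff_0_eq: "x \<in> L \<Longrightarrow> CE_diff L br act 0 c [x] = act x (c [])"
  by (simp add: CE_diff_def nths_Cons)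

lemma CE_diff_1_eq:
  "x \<in> L \<Longrightarrow> y \<in> L \<Longrightarrow>
    CE_diff L br act 1 c [x, y] = act x (c [y]) - act y (c [x]) - c [br x y]"
  by (simp add: CE_diff_def nths_Cons atMost_Suc lessThan_Suc)

lemma CE_diff_2_eq:
  "x \<in> L \<Longrightarrow> y \<in> L \<Longrightarrow> z \<in> L \<Longrightarrow>
    CE_diff L br act 2 c [x, y, z] = act x (c [y, z]) - act y (c [x, z]) + act z (c [x, y])
      - c [br x y, z] + c [br x z, y] - c [br y z, x]"
  by (simp add: CE_diff_def nths_Cons atMost_Suc lessThan_Suc numeral_2_eq_2)

section \<open>Modules without cohomology\<close>

lemma CE_cochains_zero: "(\<lambda>xs. 0) \<in> CE_cochains L u"
  by (simp add: CE_cochains_def)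

lemma CE_cochains_diff:
  assumes "c \<in> CE_cochains L u" "c' \<in> CE_cochains L u"
  shows "(\<lambda>xs. c xs - c' xs) \<in> CE_cochains L u"
proof -
  note off = CE_cochains_off[OF assms(1)] CE_cochains_off[OF assms(2)]
  have lin: "c (xs[i := a *\<^sub>R x + b *\<^sub>R y]) - c' (xs[i := a *\<^sub>R x + b *\<^sub>R y]) =
      a *\<^sub>R (c (xs[i := x]) - c' (xs[i := x])) + b *\<^sub>R (c (xs[i := y]) - c' (xs[i := y]))"
    if "x \<in> L" "y \<in> L" "length xs = u" "set xs \<subseteq> L" "i < u" for xs i a b x y
    unfolding CE_cochains_linear[OF assms(1) that(3,4,5,1,2)]
      CE_cochains_linear[OF assms(2) that(3,4,5,1,2)]
    by (simp add: scaleR_diff_right)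
  have alt: "c xs - c' xs = 0"
    if "length xs = u" "set xs \<subseteq> L" "i < j" "j < u" "xs ! i = xs ! j" for xs i j
    using CE_cochains_alt[OF assms(1) that] CE_cochains_alt[OF assms(2) that] by simp
  show ?thesis
    unfolding CE_cochains_def
    by (intro CollectI conjI allI ballI impI) (simp add: off, erule (4) lin, erule (4) alt)
qed

lemma CE_diff_diff:
  assumes "\<And>x v w. x \<in> L \<Longrightarrow> act x (v - w) = act x v - act x w"
  shows "CE_diff L br act u (\<lambda>xs. c xs - c' xs) xs = CE_diff L br act u c xs - CE_diff L br act u c' xs"
proof (cases "length xs = Suc u \<and> set xs \<subseteq> L")
  case True
  then have "xs ! i \<in> L" if "i \<le> u" for i
    using that nth_mem[of i xs] by auto
  then have "act (xs ! i) (v - w) = act (xs ! i) v - act (xs ! i) w" if "i \<le> u" for i v w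
    using assms that by blast
  with True show ?thesis
    by (simp add: CE_diff_def scaleR_diff_right sum_subtractf)
next
  case False
  then show ?thesis
    unfolding CE_diff_def by (simp only: if_False diff_self)
qed

lemma CE_diff_zero:
  assumes "\<And>x. x \<in> L \<Longrightarrow> act x 0 = 0"
  shows "CE_diff L br act u (\<lambda>xs. 0) = (\<lambda>xs. 0)"
proof
  fix xs
  have "act (xs ! i) 0 = 0" if "length xs = Suc u" "set xs \<subseteq> L" "i \<le> u" for i
  proof -
    have "xs ! i \<in> set xs"
      using that by (intro nth_mem) simp
    with that assms show ?thesis by blast
  qed
  then show "CE_diff L br act u (\<lambda>xs. 0) xs = 0"
    by (simp add: CE_diff_def)
qed

lemma CE_total_cohomology_trivial:
  assumes lin: "\<And>x v w. x \<in> L \<Longrightarrow> act x (v - w) = act x v - act x w"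
    and exact: "\<And>u. CE_cocycles L br act u \<subseteq> CE_coboundaries L br act u"
  shows "CE_total_cohomology L br act = {CE_zero_class L br act}"
proof -
  have "act x 0 = 0" if "x \<in> L" for x
    using lin[OF that, of 0 0] by simp
  note d0 = CE_diff_zero[of L act, OF this]
  have zero: "(\<lambda>xs. 0) \<in> CE_cocycles L br act u" for u
    by (simp add: CE_cocycles_def CE_cochains_zero d0)
  have "(\<lambda>xs. c xs - c' xs) \<in> CE_cocycles L br act u"
    if "c \<in> CE_cocycles L br act u" "c' \<in> CE_cocycles L br act u" for c c' u
    using that by (auto simp: CE_cocycles_def fun_eq_iff CE_cochains_diff CE_diff_diff[OF lin])
  then have cls: "CE_cohomologous L br act u `` {c} = CE_cocycles L br act u"
    if "c \<in> CE_cocycles L br act u" for u c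
    using exact[of u] that unfolding CE_cohomologous_def by blast
  then have "CE_zero_class L br act u = CE_cocycles L br act u" for u
    by (simp add: CE_zero_class_def zero)
  moreover have "CE_cohomology L br act u = {CE_cocycles L br act u}" for u
    using zero[of u] cls unfolding CE_cohomology_def quotient_def by blast
  ultimately show ?thesis
    by (auto simp: CE_total_cohomology_def fun_eq_iff)
qed

locale sl2_module =
  fixes act :: "smooth_fun \<Rightarrow> 'w::real_vector \<Rightarrow> 'w"
  assumes act_lincomb_left: "X \<in> sl2 \<Longrightarrow> Y \<in> sl2 \<Longrightarrow>
      act (a *\<^sub>R X + b *\<^sub>R Y) w = a *\<^sub>R act X w + b *\<^sub>R act Y w"
    and act_add: "X \<in> sl2 \<Longrightarrow> act X (v + w) = act X v + act X w"
    and act_scaleR: "X \<in> sl2 \<Longrightarrow> act X (a *\<^sub>R w) = a *\<^sub>R act X w"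
    and act_bracket: "X \<in> sl2 \<Longrightarrow> Y \<in> sl2 \<Longrightarrow>
      act (vf_bracket X Y) w = act X (act Y w) - act Y (act X w)"
begin

lemma act_minus: "X \<in> sl2 \<Longrightarrow> act X (v - w) = act X v - act X w"
  using act_add[of X "v - w" w] by simp

lemma act_zero: "X \<in> sl2 \<Longrightarrow> act X 0 = 0"
  using act_scaleR[of X 0 0] by simp

lemma act_coords:
  assumes "x \<in> sl2"
  shows "act x w = coord0 x *\<^sub>R act 1 w + coord1 x *\<^sub>R act ident w + coord2 x *\<^sub>R act (ident\<^sup>2) w"
proof -
  have "act (1 *\<^sub>R (coord0 x *\<^sub>R 1 + coord1 x *\<^sub>R ident) + coord2 x *\<^sub>R ident\<^sup>2) w =
      1 *\<^sub>R act (coord0 x *\<^sub>R 1 + coord1 x *\<^sub>R ident) w + coord2 x *\<^sub>R act (ident\<^sup>2) w"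
    by (intro act_lincomb_left sl2_lincomb) simp_all
  moreover have "act (coord0 x *\<^sub>R 1 + coord1 x *\<^sub>R ident) w = coord0 x *\<^sub>R act 1 w + coord1 x *\<^sub>R act ident w"
    by (intro act_lincomb_left) simp_all
  ultimately show ?thesis
    using sl2_coord[OF assms] by simp
qed

lemma act_comm:
  "act 1 (act ident w) = act ident (act 1 w) + act 1 w"
  "act 1 (act (ident\<^sup>2) w) = act (ident\<^sup>2) (act 1 w) + 2 *\<^sub>R act ident w"
  "act ident (act (ident\<^sup>2) w) = act (ident\<^sup>2) (act ident w) + act (ident\<^sup>2) w"
  using act_bracket[of 1 ident w] act_bracket[of 1 "ident\<^sup>2" w] act_bracket[of ident "ident\<^sup>2" w]
    act_lincomb_left[of ident ident 2 0 w]
  by (simp_all add: algebra_simps)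

lemmas act_linear = act_add act_scaleR act_minus act_zero

abbreviation "d \<equiv> CE_diff sl2 vf_bracket act"

lemma CE_diff_0_eqI:
  assumes c: "c \<in> CE_cochains sl2 1"
    and "act 1 w = c [1]" "act ident w = c [ident]" "act (ident\<^sup>2) w = c [ident\<^sup>2]"
  shows "c \<in> d 0 ` CE_cochains sl2 0"
proof
  show "c = d 0 (\<lambda>xs. if xs = [] then w else 0)"
  proof
    fix xs
    show "c xs = d 0 (\<lambda>xs. if xs = [] then w else 0) xs"
    proof (cases "length xs = 1 \<and> set xs \<subseteq> sl2")
      case True
      then obtain x where "xs = [x]" "x \<in> sl2"
        by (auto simp: length_Suc_conv)
      then show ?thesis
        by (simp add: CE_diff_0_eq CE_cochains_sl2_1[OF c, of x] act_coords[of x] assms)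
    qed (auto simp: CE_diff_def CE_cochains_off[OF c])
  qed
qed (rule CE_cochains_0_I)

lemma CE_diff_1_eqI:
  assumes c: "c \<in> CE_cochains sl2 2"
    and b: "act 1 h - act ident e - e = c [1, ident]"
      "act 1 f - act (ident\<^sup>2) e - 2 *\<^sub>R h = c [1, ident\<^sup>2]"
      "act ident f - act (ident\<^sup>2) h - f = c [ident, ident\<^sup>2]"
  shows "c \<in> d 1 ` CE_cochains sl2 1"
proof
  let ?g = "\<lambda>x. coord0 x *\<^sub>R e + coord1 x *\<^sub>R h + coord2 x *\<^sub>R f"
  let ?b = "\<lambda>xs. if length xs = 1 \<and> set xs \<subseteq> sl2 then ?g (xs ! 0) else 0"
  show "?b \<in> CE_cochains sl2 1"
    by (rule CE_cochains_1_I) (auto simp: sl2_lincomb algebra_simps)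
  have eq: "c [x, y] = act x (?g y) - act y (?g x) - ?g (vf_bracket x y)"
    if "x \<in> sl2" "y \<in> sl2" for x y
    unfolding CE_cochains_sl2_2[OF c that] act_coords[OF that(1)] act_coords[OF that(2)]
      coord_bracket[OF that] b[symmetric]
    by (simp add: act_linear algebra_simps)
  show "c = d 1 ?b"
  proof
    fix xs
    show "c xs = d 1 ?b xs"
    proof (cases "length xs = 2 \<and> set xs \<subseteq> sl2")
      case True
      then obtain x y where xs: "xs = [x, y]" and xy: "x \<in> sl2" "y \<in> sl2"
        by (auto simp: length_Suc_conv numeral_2_eq_2)
      show ?thesis
        unfolding xs CE_diff_1_eq[OF xy] using eq[OF xy] xy by (simp add: sl2_bracket)
    qed (auto simp: CE_diff_def CE_cochains_off[OF c])
  qed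
qed

lemma CE_diff_2_eqI:
  assumes c: "c \<in> CE_cochains sl2 3"
    and w: "act 1 w = c [1, ident, ident\<^sup>2]"
  shows "c \<in> d 2 ` CE_cochains sl2 2"
proof
  let ?g = "\<lambda>x y. (coord1 x * coord2 y - coord1 y * coord2 x) *\<^sub>R w"
  let ?b = "\<lambda>xs. if length xs = 2 \<and> set xs \<subseteq> sl2 then ?g (xs ! 0) (xs ! 1) else 0"
  show "?b \<in> CE_cochains sl2 2"
    by (rule CE_cochains_2_I) (auto simp: sl2_lincomb algebra_simps)
  have eq: "c [x, y, z] = act x (?g y z) - act y (?g x z) + act z (?g x y)
      - ?g (vf_bracket x y) z + ?g (vf_bracket x z) y - ?g (vf_bracket y z) x"
    if "x \<in> sl2" "y \<in> sl2" "z \<in> sl2" for x y z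
    unfolding CE_cochains_sl2_3[OF c that] act_coords[OF that(1)] act_coords[OF that(2)]
      act_coords[OF that(3)] coord_bracket[OF that(1,2)] coord_bracket[OF that(1,3)]
      coord_bracket[OF that(2,3)] w[symmetric]
    by (simp add: act_linear algebra_simps)
  show "c = d 2 ?b"
  proof
    fix xs
    show "c xs = d 2 ?b xs"
    proof (cases "length xs = 3 \<and> set xs \<subseteq> sl2")
      case True
      then obtain x y z where xs: "xs = [x, y, z]" and xyz: "x \<in> sl2" "y \<in> sl2" "z \<in> sl2"
        by (auto simp: length_Suc_conv numeral_3_eq_3)
      show ?thesis
        unfolding xs CE_diff_2_eq[OF xyz] using eq[OF xyz] xyz by (simp add: sl2_bracket)
    qed (auto simp: CE_diff_def CE_cochains_off[OF c])
  qed
qed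

end

text \<open>Since \<open>d/dt\<close> acts surjectively, every cocycle is cohomologous to one that vanishes as
  soon as one argument is \<open>d/dt\<close>. The last two assumptions state that such cocycles of degree 1,
  with values \<open>p\<close>, \<open>q\<close> on \<open>t d/dt\<close>, \<open>t\<^sup>2 d/dt\<close>, and of degree 2, with value \<open>g\<close> on that
  pair, are coboundaries.\<close>

locale sl2_acyclic_module = sl2_module +
  assumes act_1_surj: "\<exists>v. act 1 v = w"
    and invariant_zero: "act 1 w = 0 \<Longrightarrow> act ident w = 0 \<Longrightarrow> act (ident\<^sup>2) w = 0 \<Longrightarrow> w = 0"
    and relative_1_cocycle: "act 1 p = 0 \<Longrightarrow> act 1 q = 2 *\<^sub>R p \<Longrightarrow>
      act ident q - act (ident\<^sup>2) p = q \<Longrightarrow>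
      \<exists>w. act 1 w = 0 \<and> act ident w = p \<and> act (ident\<^sup>2) w = q"
    and relative_2_cocycle: "act 1 g = 0 \<Longrightarrow>
      \<exists>p q. act 1 p = 0 \<and> act 1 q = 2 *\<^sub>R p \<and> act ident q - act (ident\<^sup>2) p - q = g"
begin

lemma cocycle_0:
  assumes "c \<in> CE_cocycles sl2 vf_bracket act 0"
  shows "c = (\<lambda>xs. 0)"
proof
  fix xs
  have c: "c \<in> CE_cochains sl2 0" "d 0 c = (\<lambda>xs. 0)"
    using assms by (auto simp: CE_cocycles_def)
  have "act x (c []) = 0" if "x \<in> sl2" for x
    using CE_diff_0_eq[OF that, of vf_bracket act c] c(2) by simp
  then have "c [] = 0"
    using invariant_zero by simp
  then show "c xs = 0"
    using CE_cochains_off[OF c(1), of xs] by (cases "xs = []") auto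
qed

lemma cocycle_1:
  assumes "c \<in> CE_cocycles sl2 vf_bracket act 1"
  shows "c \<in> d 0 ` CE_cochains sl2 0"
proof -
  have c: "c \<in> CE_cochains sl2 1" "d 1 c = (\<lambda>xs. 0)"
    using assms by (auto simp: CE_cocycles_def)
  have cc: "act x (c [y]) - act y (c [x]) - c [vf_bracket x y] = 0" if "x \<in> sl2" "y \<in> sl2" for x y
    using CE_diff_1_eq[OF that, of vf_bracket act c] c(2) by simp
  have c2: "c [2 *\<^sub>R ident] = 2 *\<^sub>R c [ident]"
    using CE_cochains_sl2_1[OF c(1), of "2 *\<^sub>R ident"] sl2_lincomb[of ident ident 2 0] by simp
  obtain v where v: "act 1 v = c [1]"
    using act_1_surj by blast
  define p where "p = c [ident] - act ident v"
  define q where "q = c [ident\<^sup>2] - act (ident\<^sup>2) v"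
  have "\<exists>w. act 1 w = 0 \<and> act ident w = p \<and> act (ident\<^sup>2) w = q"
  proof (rule relative_1_cocycle)
    show "act 1 p = 0"
      using cc[of 1 ident] by (simp add: p_def act_linear act_comm v algebra_simps)
    show "act 1 q = 2 *\<^sub>R p"
      using cc[of 1 "ident\<^sup>2"] by (simp add: p_def q_def act_linear act_comm v c2 algebra_simps)
    show "act ident q - act (ident\<^sup>2) p = q"
      using cc[of ident "ident\<^sup>2"] by (simp add: p_def q_def act_linear act_comm algebra_simps)
  qed
  then obtain w where "act 1 w = 0" "act ident w = p" "act (ident\<^sup>2) w = q"
    by blast
  then show ?thesis
    by (intro CE_diff_0_eqI[OF c(1), of "v + w"]) (simp_all add: act_linear v p_def q_def)
qed

lemma cocycle_2:
  assumes "c \<in> CE_cocycles sl2 vf_bracket act 2"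
  shows "c \<in> d 1 ` CE_cochains sl2 1"
proof -
  have c: "c \<in> CE_cochains sl2 2" "d 2 c = (\<lambda>xs. 0)"
    using assms by (auto simp: CE_cocycles_def)
  have ex: "c [x, y] = (coord0 x * coord1 y - coord0 y * coord1 x) *\<^sub>R c [1, ident] +
    (coord0 x * coord2 y - coord0 y * coord2 x) *\<^sub>R c [1, ident\<^sup>2] +
    (coord1 x * coord2 y - coord1 y * coord2 x) *\<^sub>R c [ident, ident\<^sup>2]" if "x \<in> sl2" "y \<in> sl2" for x y
    by (rule CE_cochains_sl2_2[OF c(1) that])
  have "2 *\<^sub>R ident \<in> sl2"
    using sl2_lincomb[of ident ident 2 0] by simp
  then have cc: "act 1 (c [ident, ident\<^sup>2]) - act ident (c [1, ident\<^sup>2]) + act (ident\<^sup>2) (c [1, ident]) = 0"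
    using CE_diff_2_eq[of 1 sl2 ident "ident\<^sup>2" vf_bracket act c] c(2)
      ex[of "2 *\<^sub>R ident" ident] ex[of "ident\<^sup>2" 1]
    by simp
  obtain h where h: "act 1 h = c [1, ident]"
    using act_1_surj by blast
  obtain f where f: "act 1 f = c [1, ident\<^sup>2] + 2 *\<^sub>R h"
    using act_1_surj by blast
  define g where "g = c [ident, ident\<^sup>2] - (act ident f - act (ident\<^sup>2) h - f)"
  have "act 1 g = 0"
    using cc by (simp add: g_def act_linear act_comm h f algebra_simps)
  then obtain p q where pq: "act 1 p = 0" "act 1 q = 2 *\<^sub>R p" "act ident q - act (ident\<^sup>2) p - q = g"
    using relative_2_cocycle by blast
  show ?thesis
  proof (rule CE_diff_1_eqI[OF c(1), of "h + p" 0 "f + q"])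
    show "act ident (f + q) - act (ident\<^sup>2) (h + p) - (f + q) = c [ident, ident\<^sup>2]"
      using pq(3) by (simp add: g_def act_linear algebra_simps)
  qed (simp_all add: act_linear h f pq(1,2) algebra_simps)
qed

lemma cocycle_3:
  assumes "c \<in> CE_cocycles sl2 vf_bracket act 3"
  shows "c \<in> d 2 ` CE_cochains sl2 2"
  using assms act_1_surj CE_diff_2_eqI unfolding CE_cocycles_def by blast

lemma cocycles_subset_coboundaries:
  "CE_cocycles sl2 vf_bracket act u \<subseteq> CE_coboundaries sl2 vf_bracket act u"
proof
  fix c assume c: "c \<in> CE_cocycles sl2 vf_bracket act u"
  show "c \<in> CE_coboundaries sl2 vf_bracket act u"
  proof (cases "u \<ge> 4")
    case True
    then obtain k where k: "u = Suc k"
      by (cases u) auto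
    have "c = (\<lambda>xs. 0)"
      using c True CE_cochains_sl2_ge_4 by (auto simp: CE_cocycles_def)
    moreover have "d k (\<lambda>xs. 0) = (\<lambda>xs. 0)"
      by (rule CE_diff_zero) (rule act_zero)
    ultimately have "c = d k (\<lambda>xs. 0)"
      by simp
    then show ?thesis
      using CE_cochains_zero[of sl2 k] unfolding k CE_coboundaries.simps by blast
  next
    case False
    then have "u = 0 \<or> u = Suc 0 \<or> u = Suc 1 \<or> u = Suc 2"
      by arith
    then show ?thesis
      using c cocycle_0 cocycle_1 cocycle_2 cocycle_3
      by (elim disjE) (simp_all add: numeral_2_eq_2 numeral_3_eq_3)
  qed
qed

lemma total_cohomology_trivial:
  "CE_total_cohomology sl2 vf_bracket act = {CE_zero_class sl2 vf_bracket act}"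
  using CE_total_cohomology_trivial[OF act_minus cocycles_subset_coboundaries] .

end

section \<open>The module of differential operators\<close>

lemma sl2_module_lie_diff_op: "sl2_module (lie_diff_op l m)"
proof
  have lin: "op_app A (a *\<^sub>R v + b *\<^sub>R w) = a *\<^sub>R op_app A v + b *\<^sub>R op_app A w" for A a b v w
  proof -
    obtain n a where "A = coeff_op n a"
      by (meson coeff_op_exists order_refl)
    then show ?thesis
      by (simp add: coeff_op.rep_eq D_pow_add D_pow_scaleR algebra_simps sum.distrib scaleR_sum_right)
  qed
  note rep = diff_op_eq_iff lie_diff_op.rep_eq plus_diff_op.rep_eq scaleR_diff_op.rep_eq
  have dens: "lie_density k (a *\<^sub>R X + b *\<^sub>R Y) v = a *\<^sub>R lie_density k X v + b *\<^sub>R lie_density k Y v"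
    for k a b X Y v
    by (simp add: lie_density_def D_add D_scaleR algebra_simps)
  show "lie_diff_op l m (a *\<^sub>R X + b *\<^sub>R Y) A = a *\<^sub>R lie_diff_op l m X A + b *\<^sub>R lie_diff_op l m Y A"
    for a b A X Y
    by (simp add: rep dens lin algebra_simps)
  show "lie_diff_op l m X (A + B) = lie_diff_op l m X A + lie_diff_op l m X B" for A B X
    by (simp add: rep lie_density_def D_add algebra_simps)
  show "lie_diff_op l m X (a *\<^sub>R A) = a *\<^sub>R lie_diff_op l m X A" for a A X
    by (simp add: rep lie_density_def D_scaleR algebra_simps)
qed (rule lie_diff_op_bracket)

lemma sl2_acyclic_module_lie_diff_op:
  assumes "nonresonant l m"
  shows "sl2_acyclic_module (lie_diff_op l m)"
proof (intro sl2_acyclic_module.intro sl2_module_lie_diff_op sl2_acyclic_module_axioms.intro)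
  show "\<exists>v. lie_diff_op l m 1 v = w" for w
    by (rule lie_diff_op_1_surj)
qed (fact invariant_eq_0[OF assms] invariant_1_cocycle[OF assms] invariant_2_cocycle[OF assms])+

theorem theorem9p5:
  fixes lam mu delta :: real
  assumes "delta = mu - lam"
    and "delta \<notin> \<nat> \<or> (delta \<in> \<nat> \<and> delta \<noteq> 0 \<and> lam \<noteq> (1 - delta) / 2)"
  shows "CE_total_cohomology sl2 vf_bracket (lie_diff_op lam mu) =
           {CE_zero_class sl2 vf_bracket (lie_diff_op lam mu)}"
proof -
  have "real k + 2 * lam \<noteq> 0" if "delta = real k + 1" for k
  proof -
    have "delta \<in> \<nat>"
      using that by (metis of_nat_Suc of_nat_in_Nats add.commute)
    with assms(2) that show ?thesis
      by (auto simp: field_simps)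
  qed
  moreover have "mu \<noteq> lam"
    using assms by auto
  ultimately have "nonresonant lam mu"
    by (auto simp: nonresonant_def assms(1))
  then interpret sl2_acyclic_module "lie_diff_op lam mu"
    by (rule sl2_acyclic_module_lie_diff_op)
  show ?thesis
    by (rule total_cohomology_trivial)
qed

end
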